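(* Let $r\geq 3$ be an integer and let $G$ be a finite simple $K_{1,r}$-free graph. If $\delta(G)\geq \left\lfloor\frac{r}{2}\right\rfloor+2$, then $G$ is a $\mathcal{P}_{\geq 3}$-factor covered graph, i.e., for every edge $e\in E(G)$ there is a $\mathcal{P}_{\geq 3}$-factor of $G$ containing $e$.
   Context: All graphs are finite and simple. $\delta(G)$ is the minimum degree of $G$. $K_{1,r}$ denotes the star with one center vertex adjacent to $r$ leaves; $G$ is $K_{1,r}$-free if it contains no induced subgraph isomorphic to $K_{1,r}$. For an integer $k\geq 2$, a $\mathcal{P}_{\geq k}$-factor of $G$ is a spanning subgraph of $G$ every connected component of which is a path with at least $k$ vertices. $G$ is a $\mathcal{P}_{\geq k}$-factor covered graph if for every $e\in E(G)$ there is a $\mathcal{P}_{\geq k}$-factor of $G$ whose edge set contains $e$. *)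

theory Defs
  imports "Graph_Theory.Graph_Theory"
begin

text \<open>
  A finite simple graph is a \<^const>\<open>graph\<close> (finite, symmetric, no loops, no parallel arcs) of
  the Graph\_Theory entry; an undirected edge is a pair of opposite arcs.  Subgraphs that are
  meant as undirected graphs are therefore required to be symmetric as well, and then contain
  both arcs of an edge as soon as they contain one of them.
\<close>

text \<open>Without parallel arcs, the out-degree of a vertex is the number of its neighbours.\<close>

definition min_degree :: "('a,'b) pre_digraph \<Rightarrow> nat" where
  "min_degree G = Min (out_degree G ` verts G)"

definition star_free :: "nat \<Rightarrow> ('a,'b) pre_digraph \<Rightarrow> bool" where
  "star_free r G \<longleftrightarrow>
     \<not> (\<exists>H. induced_subgraph H G \<and> complete_bipartite_digraph 1 r H)"

definition components :: "('a,'b) pre_digraph \<Rightarrow> ('a,'b) pre_digraph set" where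
  "components G = {C. pre_digraph.max_subgraph G connected C}"

definition path_graph :: "nat \<Rightarrow> ('a,'b) pre_digraph \<Rightarrow> bool" where
  "path_graph n P \<longleftrightarrow> graph P \<and>
     (\<exists>p. distinct p \<and> length p = n \<and> verts P = set p \<and>
        arcs_ends P = {(u, v). \<exists>i. Suc i < n \<and>
          (u = p ! i \<and> v = p ! Suc i \<or> u = p ! Suc i \<and> v = p ! i)})"

definition path_factor :: "nat \<Rightarrow> ('a,'b) pre_digraph \<Rightarrow> ('a,'b) pre_digraph \<Rightarrow> bool" where
  "path_factor k H G \<longleftrightarrow> graph H \<and> spanning H G \<and>
     (\<forall>C \<in> components H. \<exists>n\<ge>k. path_graph n C)"

definition path_factor_covered :: "nat \<Rightarrow> ('a,'b) pre_digraph \<Rightarrow> bool" where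
  "path_factor_covered k G \<longleftrightarrow>
     (\<forall>e \<in> arcs G. \<exists>H. path_factor k H G \<and> e \<in> arcs H)"

end

theory Submission
  imports Defs "HOL-Library.Multiset"
begin

text \<open>
  To force an edge \<open>cd\<close> into the factor, delete it and attach a pendant vertex to each of \<open>c\<close> and
  \<open>d\<close>; it suffices to partition the new graph into paths with at least three vertices.  Take a
  partition into paths with as few paths on one or two vertices (``pieces'') as possible and grow an
  alternating tree from a piece.  Whenever the growing end of a piece is adjacent to an inner vertex
  \<open>x\<close> of another path, that path is cut at \<open>x\<close> into two further pieces, for otherwise the number of
  short paths could be decreased.  Any piece of the tree can be made the leftover one, so at a maximal
  tree the growing ends form an independent set \<open>L\<close>, each member of which has at most one
  neighbour outside the set \<open>X\<close> of cut vertices, and \<open>|L| = 2|X| + 1\<close>.  Discarding at most two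
  members of \<open>L\<close> near \<open>c\<close> and \<open>d\<close>, each of the others has at least \<open>h = r div 2 + 1\<close>
  neighbours in \<open>X\<close>, whereas a vertex of \<open>X\<close> has at most \<open>r - 1\<close> neighbours in \<open>L\<close>.
  Hence \<open>(2|X| - 1) h \<le> (r - 1) |X|\<close>, which contradicts \<open>|X| \<ge> h\<close>.
\<close>


section \<open>Paths, short pieces and alternating trees\<close>

definition vsum :: "'v list multiset \<Rightarrow> 'v multiset" where
  "vsum N = \<Sum>\<^sub># (image_mset mset N)"

lemma vsum_simps [simp]:
  "vsum {#} = {#}" "vsum (add_mset p N) = mset p + vsum N" "vsum (M + N) = vsum M + vsum N"
  by (simp_all add: vsum_def)

type_synonym 'v step = "'v list \<times> 'v \<times> 'v list \<times> 'v list"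

locale finite_simple_relation =
  fixes V :: "'v set" and E :: "'v \<Rightarrow> 'v \<Rightarrow> bool"
  assumes finite_V: "finite V"
    and E_in_V: "E u v \<Longrightarrow> u \<in> V"
    and E_sym: "E u v \<Longrightarrow> E v u"
    and E_irrefl: "\<not> E u u"
begin

definition lpath :: "'v list \<Rightarrow> bool" where
  "lpath p \<longleftrightarrow> p \<noteq> [] \<and> successively E p"

definition piece :: "'v list \<Rightarrow> bool" where
  "piece p \<longleftrightarrow> lpath p \<and> length p \<le> 2"

definition long :: "'v list \<Rightarrow> bool" where
  "long p \<longleftrightarrow> lpath p \<and> 3 \<le> length p"

lemma lpath_ne: "lpath p \<Longrightarrow> p \<noteq> []"
  by (simp add: lpath_def)

lemma lpath_singleton [simp]: "lpath [x]"
  by (simp add: lpath_def)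

lemma lpath_append: "p \<noteq> [] \<Longrightarrow> q \<noteq> [] \<Longrightarrow> lpath (p @ q) \<longleftrightarrow> lpath p \<and> lpath q \<and> E (last p) (hd q)"
  by (auto simp: lpath_def successively_append_iff)

lemma lpath_Cons: "q \<noteq> [] \<Longrightarrow> lpath (x # q) \<longleftrightarrow> lpath q \<and> E x (hd q)"
  using lpath_append[of "[x]" q] by simp

lemma lpath_rev [simp]: "lpath (rev p) \<longleftrightarrow> lpath p"
  using E_sym by (auto simp: lpath_def elim!: successively_mono)

lemma piece_cases:
  assumes "piece p"
  obtains x where "p = [x]" | x y where "p = [x, y]" "E x y"
proof (cases p)
  case (Cons x p')
  then show ?thesis using assms that
    by (cases p') (auto simp: piece_def lpath_def)
qed (use assms in \<open>simp add: piece_def lpath_def\<close>)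

text \<open>A path \<open>rev a @ [x] @ b\<close> hanging off the last vertex of \<open>q\<close> at its inner vertex \<open>x\<close>: when
  \<open>q\<close> is left over, \<open>q @ [x] @ b\<close> is a path and \<open>a\<close> becomes the leftover piece.\<close>

definition fork :: "'v list \<Rightarrow> 'v \<Rightarrow> 'v list \<Rightarrow> 'v list \<Rightarrow> bool" where
  "fork q x a b \<longleftrightarrow> piece a \<and> piece b \<and> E (last q) x \<and> E x (hd a) \<and> E x (hd b)"

lemma fork_commute: "fork q x a b \<longleftrightarrow> fork q x b a"
  by (auto simp: fork_def)

text \<open>Steps are stored newest first, and the last vertex of a piece is the one the tree grows from.\<close>

fun pieces :: "'v list \<Rightarrow> 'v step list \<Rightarrow> 'v list set" where
  "pieces r [] = {r}"
| "pieces r ((q, x, a, b) # ss) = insert a (insert b (pieces r ss))"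

text \<open>Disjointness is not built in. Where it matters, it is derived from \<open>tverts\<close>
  being a submultiset of \<open>mset_set V\<close>.\<close>

fun tree :: "'v list \<Rightarrow> 'v step list \<Rightarrow> bool" where
  "tree r [] \<longleftrightarrow> piece r"
| "tree r ((q, x, a, b) # ss) \<longleftrightarrow> tree r ss \<and> q \<in> pieces r ss \<and> fork q x a b"

fun tverts :: "'v list \<Rightarrow> 'v step list \<Rightarrow> 'v multiset" where
  "tverts r [] = mset r"
| "tverts r ((q, x, a, b) # ss) = mset a + {#x#} + mset b + tverts r ss"

lemma tree_piece: "tree r ss \<Longrightarrow> p \<in> pieces r ss \<Longrightarrow> piece p"
  by (induction r ss rule: tree.induct) (auto simp: fork_def)

lemma long_fork: "fork q x a b \<Longrightarrow> long (rev a @ [x] @ b)"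
  by (cases a; cases b)
    (auto simp: fork_def piece_def long_def lpath_append lpath_Cons lpath_ne hd_rev last_rev E_sym
      dest: lpath_ne simp del: rev.simps)

lemma long_through: "fork q x a b \<Longrightarrow> lpath q \<Longrightarrow> long (q @ [x] @ b)"
  using lpath_ne[of q] lpath_ne[of b]
  by (auto simp: fork_def piece_def long_def lpath_append lpath_Cons)
    (metis One_nat_def Suc_le_eq add_mono length_greater_0_conv one_add_one)

lemma long_extend: "long p \<Longrightarrow> lpath q \<Longrightarrow> E (last p) (hd q) \<Longrightarrow> long (p @ q)"
  by (auto simp: long_def lpath_append lpath_ne)

section \<open>Exchanges in the tree: choosing the piece that is left over\<close>

definition frees :: "'v list \<Rightarrow> 'v step list \<Rightarrow> 'v list \<Rightarrow> 'v list multiset \<Rightarrow> bool" where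
  "frees r ss p N \<longleftrightarrow> (\<forall>t\<in>#N. long t) \<and> tverts r ss = mset p + vsum N"

text \<open>Paths are switched along the branch from \<open>p\<close> to the root: to free
  \<open>a\<close>, first \<open>q\<close> is freed and then absorbed into
  \<open>q @ [x] @ b\<close>. Steps off the branch keep their paths.\<close>

lemma ex_frees: "tree r ss \<Longrightarrow> p \<in> pieces r ss \<Longrightarrow> \<exists>N. frees r ss p N"
proof (induction r ss arbitrary: p rule: tree.induct)
  case (1 r)
  then show ?case by (intro exI[of _ "{#}"]) (simp add: frees_def)
next
  case (2 r q x a b ss)
  then have f: "fork q x a b" and q: "lpath q"
    using tree_piece by (auto simp: piece_def)
  obtain Nq where Nq: "frees r ss q Nq" using 2 by auto
  consider "p \<in> pieces r ss" | "p = a" | "p = b" using 2 by auto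
  then show ?case
  proof cases
    case 1
    then obtain N where "frees r ss p N" using 2 by auto
    then show ?thesis using long_fork[OF f]
      by (intro exI[of _ "add_mset (rev a @ [x] @ b) N"]) (simp add: frees_def)
  next
    case 2
    then show ?thesis using long_through[OF f q] Nq
      by (intro exI[of _ "add_mset (q @ [x] @ b) Nq"]) (simp add: frees_def)
  next
    case 3
    then show ?thesis using long_through[OF _ q, of x b a] f Nq
      by (intro exI[of _ "add_mset (q @ [x] @ a) Nq"]) (simp add: frees_def fork_commute)
  qed
qed

text \<open>Here \<open>t\<close> stays the end of a long path, so it can still be extended at its last vertex.\<close>

definition frees_keeps :: "'v list \<Rightarrow> 'v step list \<Rightarrow> 'v list \<Rightarrow> 'v list \<Rightarrow> bool" where
  "frees_keeps r ss p t \<longleftrightarrow> (\<exists>A N. A \<noteq> [] \<and> long (A @ t) \<and> frees r ss p (add_mset (A @ t) N))"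

definition augments :: "'v list \<Rightarrow> 'v step list \<Rightarrow> bool" where
  "augments r ss \<longleftrightarrow> (\<exists>N. (\<forall>t\<in>#N. long t) \<and> tverts r ss = vsum N)"

lemma frees_keeps_Cons:
  assumes "frees_keeps r ss p t" "fork q x a b"
  shows "frees_keeps r ((q, x, a, b) # ss) p t"
proof -
  obtain A N where "A \<noteq> []" "long (A @ t)" "frees r ss p (add_mset (A @ t) N)"
    using assms by (auto simp: frees_keeps_def)
  then show ?thesis unfolding frees_keeps_def using long_fork[OF assms(2)]
    by (intro exI[of _ A] exI[of _ "add_mset (rev a @ [x] @ b) N"]) (simp add: frees_def)
qed

lemma augments_Cons:
  assumes "augments r ss" "fork q x a b"
  shows "augments r ((q, x, a, b) # ss)"
proof -
  obtain N where "\<forall>t\<in>#N. long t" "tverts r ss = vsum N"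
    using assms by (auto simp: augments_def)
  then show ?thesis unfolding augments_def using long_fork[OF assms(2)]
    by (intro exI[of _ "add_mset (rev a @ [x] @ b) N"]) simp
qed

text \<open>While an older piece is freed, the path of the newest step stays whole; read one way it
  ends in \<open>b\<close>, read the other way in \<open>a\<close>.\<close>

lemma frees_keeps_new:
  assumes "tree r ss" "q \<in> pieces r ss" "fork q x a b" "p \<in> pieces r ss" "t = a \<or> t = b"
  shows "frees_keeps r ((q, x, a, b) # ss) p t"
proof -
  obtain N where N: "frees r ss p N" using ex_frees assms by blast
  show ?thesis
    using assms(5)
  proof
    assume t: "t = b"
    then show ?thesis unfolding frees_keeps_def using N long_fork[OF assms(3)]
      by (intro exI[of _ "rev a @ [x]"] exI[of _ N]) (simp add: frees_def)
  next
    assume t: "t = a"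
    then show ?thesis unfolding frees_keeps_def using N long_fork[of q x b a] assms(3)
      by (intro exI[of _ "rev b @ [x]"] exI[of _ N]) (simp add: frees_def fork_commute)
  qed
qed

text \<open>Once \<open>q\<close> is freed, either sibling can finish the path through
  \<open>q\<close> and \<open>x\<close>, and the other one is left over.\<close>

lemma frees_keeps_sibling:
  assumes "tree r ss" "q \<in> pieces r ss" "fork q x a b"
  shows "frees_keeps r ((q, x, a, b) # ss) a b" "frees_keeps r ((q, x, a, b) # ss) b a"
proof -
  obtain N where N: "frees r ss q N" using ex_frees assms by blast
  have q: "lpath q" using tree_piece assms by (auto simp: piece_def)
  show "frees_keeps r ((q, x, a, b) # ss) a b"
    unfolding frees_keeps_def using N long_through[OF assms(3) q]
    by (intro exI[of _ "q @ [x]"] exI[of _ N]) (simp add: frees_def)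
  show "frees_keeps r ((q, x, a, b) # ss) b a"
    unfolding frees_keeps_def using N long_through[of q x b a, OF _ q] assms(3)
    by (intro exI[of _ "q @ [x]"] exI[of _ N]) (simp add: frees_def fork_commute)
qed

text \<open>The induction goes back to the newest step that creates one of the two pieces; the piece
  created there can be the kept one.\<close>

lemma frees_keeps_cases:
  assumes "tree r ss" "p \<in> pieces r ss" "t \<in> pieces r ss" "p \<noteq> t"
  shows "frees_keeps r ss p t \<or> frees_keeps r ss t p"
  using assms
proof (induction r ss rule: tree.induct)
  case (2 r q x a b ss)
  then have T: "tree r ss" and q: "q \<in> pieces r ss" and f: "fork q x a b" by auto
  consider "p \<in> pieces r ss" "t \<in> pieces r ss" | "p \<in> pieces r ss" "t = a \<or> t = b"
    | "t \<in> pieces r ss" "p = a \<or> p = b" | "{p, t} = {a, b}"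
    using 2 by auto
  then show ?case
  proof cases
    case 1
    then show ?thesis using 2 frees_keeps_Cons by auto
  next
    case 4
    then show ?thesis using frees_keeps_sibling[OF T q f] by (auto simp: doubleton_eq_iff)
  qed (use frees_keeps_new[OF T q f] in blast)+
qed auto

text \<open>With at most two vertices, every vertex of a piece is an end of it.\<close>

lemma piece_orient:
  assumes "piece p" "v \<in> set p"
  shows "\<exists>p'. lpath p' \<and> hd p' = v \<and> mset p' = mset p \<and> length p' = length p"
  using assms(1)
proof (cases rule: piece_cases)
  case (2 x y)
  then show ?thesis using assms(2) E_sym
    by (intro exI[of _ "if v = x then [x, y] else [y, x]"]) (auto simp: lpath_def)
qed (use assms(2) in \<open>auto intro!: exI[of _ p]\<close>)

text \<open>The leftover piece is appended to the long path ending in \<open>t\<close>, after which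
  nothing is left over.\<close>

lemma augments_keep:
  assumes "frees_keeps r ss p t" "piece p" "t \<noteq> []" "v \<in> set p" "E (last t) v"
  shows "augments r ss"
proof -
  obtain A N where A: "long (A @ t)" "frees r ss p (add_mset (A @ t) N)"
    using assms by (auto simp: frees_keeps_def)
  obtain p' where p': "lpath p'" "hd p' = v" "mset p' = mset p"
    using piece_orient assms by blast
  have "long ((A @ t) @ p')" using A p' assms long_extend[of "A @ t" p'] by simp
  then show ?thesis using A p' unfolding augments_def frees_def
    by (intro exI[of _ "add_mset ((A @ t) @ p') N"]) auto
qed

text \<open>The only edges from the last vertex of a piece to another piece that do not immediately
  yield an augmentation; they create a triangle with three pendant vertices.\<close>

definition bad_step :: "'v list \<Rightarrow> 'v \<Rightarrow> 'v list \<Rightarrow> 'v list \<Rightarrow> bool" where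
  "bad_step q x a b \<longleftrightarrow>
     (length a = 2 \<and> E (last q) (hd a)) \<or> (length b = 2 \<and> E (last q) (hd b))"

text \<open>If \<open>v\<close> is the far end of \<open>a\<close>, the freed \<open>p\<close> is
  appended there. If \<open>v\<close> is the near end of a two-vertex \<open>a\<close>, then
  \<open>a\<close> is detached from \<open>x\<close> and goes to \<open>p\<close>, while
  \<open>x # b\<close> goes to \<open>q\<close>.\<close>

lemma conflict_with_new:
  assumes T: "tree r ss" and q: "q \<in> pieces r ss" and f: "fork q x a b"
    and p: "p \<in> pieces r ss" "p \<noteq> q" and v: "v \<in> set a" "E (last p) v"
  shows "augments r ((q, x, a, b) # ss)"
proof -
  have pa: "piece a" "piece b" "piece p" "piece q"
    using f tree_piece[OF T] p q by (auto simp: fork_def)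
  have ne: "p \<noteq> []" "q \<noteq> []" using pa by (auto simp: piece_def lpath_def)
  consider "v = last a" | y where "a = [v, y]"
    using pa(1) v(1) by (cases rule: piece_cases) auto
  then show ?thesis
  proof cases
    case 1
    have "frees_keeps r ((q, x, a, b) # ss) p a"
      using frees_keeps_new[OF T q f p(1)] by simp
    then show ?thesis using augments_keep[of r _ p a "last p"] pa 1 v E_sym ne
      by (auto simp: piece_def lpath_ne)
  next
    case (2 y)
    have vy: "lpath [v, y]" using pa 2 by (simp add: piece_def)
    \<comment> \<open>In the older tree one of \<open>p\<close> and \<open>q\<close> already ends a
      long path; the other is left over there and becomes long through the part it receives.\<close>
    from frees_keeps_cases[OF T p(1) q p(2)] show ?thesis
    proof
      assume "frees_keeps r ss p q"
      then obtain A N where A: "long (A @ q)" "frees r ss p (add_mset (A @ q) N)"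
        by (auto simp: frees_keeps_def)
      have "long ((A @ q) @ x # b)"
        using A f pa ne long_extend[of "A @ q" "x # b"]
        by (simp add: fork_def piece_def lpath_Cons lpath_ne)
      moreover have "long (p @ [v, y])"
        using pa vy v ne lpath_append[of p "[v, y]"] by (simp add: long_def piece_def Suc_le_eq)
      ultimately show ?thesis unfolding augments_def using A 2
        by (intro exI[of _ "{#(A @ q) @ x # b, p @ [v, y]#} + N"]) (auto simp: frees_def)
    next
      assume "frees_keeps r ss q p"
      then obtain A N where A: "long (A @ p)" "frees r ss q (add_mset (A @ p) N)"
        by (auto simp: frees_keeps_def)
      have "long ((A @ p) @ [v, y])"
        using A vy v ne long_extend[of "A @ p" "[v, y]"] by simp
      moreover have "long (q @ [x] @ b)"
        using long_through[OF f] pa by (simp add: piece_def)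
      ultimately show ?thesis unfolding augments_def using A 2
        by (intro exI[of _ "{#(A @ p) @ [v, y], q @ [x] @ b#} + N"]) (auto simp: frees_def)
    qed
  qed
qed

text \<open>A vertex of \<open>a\<close> other than \<open>last a\<close> is the head of a
  two-vertex list, which would make the step bad. At \<open>last a\<close> the freed
  \<open>q\<close> can be appended.\<close>

lemma conflict_with_parent:
  assumes T: "tree r ss" and q: "q \<in> pieces r ss" and f: "fork q x a b"
    and v: "v \<in> set a" "E (last q) v" and nb: "\<not> bad_step q x a b"
  shows "augments r ((q, x, a, b) # ss)"
proof -
  have "v = last a" using f v nb
    by (auto simp: fork_def bad_step_def elim!: piece_cases)
  then show ?thesis
    using augments_keep[of r _ q a "last q"] frees_keeps_new[OF T q f q] f v E_sym tree_piece[OF T q]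
    by (auto simp: fork_def piece_def lpath_ne)
qed

text \<open>Induction reduces this to the newest step creating \<open>p\<close> or \<open>t\<close>.
  If \<open>p\<close> is new, it is kept and \<open>t\<close> is freed; if only \<open>t\<close> is
  new, \<open>conflict_with_new\<close> and \<open>conflict_with_parent\<close> apply.\<close>

lemma conflict:
  assumes "tree r ss" "p \<in> pieces r ss" "t \<in> pieces r ss" "p \<noteq> t" "v \<in> set t" "E (last p) v"
  shows "augments r ss \<or> (\<exists>q x a b. (q, x, a, b) \<in> set ss \<and> bad_step q x a b)"
  using assms
proof (induction r ss rule: tree.induct)
  case (2 r q x a b ss)
  then have T: "tree r ss" and q: "q \<in> pieces r ss" and f: "fork q x a b" by auto
  have f': "fork q x b a" using f fork_commute by auto
  have pp: "piece p" "piece t" using 2 tree_piece by blast+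
  then have ne: "p \<noteq> []" by (auto simp: piece_def lpath_def)
  \<comment> \<open>Swapping \<open>a\<close> and \<open>b\<close> does not change the vertices, so
    the lemmas about \<open>a\<close> also serve \<open>b\<close>.\<close>
  have sw: "augments r ((q, x, b, a) # ss) = augments r ((q, x, a, b) # ss)"
    by (simp add: augments_def ac_simps)
  consider "p \<in> pieces r ss" "t \<in> pieces r ss" | "p \<in> pieces r ss" "t = a \<or> t = b"
    | "t \<in> pieces r ss" "p = a \<or> p = b" | "{p, t} = {a, b}"
    using 2 by auto
  then show ?case
  proof cases
    case 1
    then have "augments r ss \<or> (\<exists>q x a b. (q, x, a, b) \<in> set ss \<and> bad_step q x a b)"
      using "2.IH" T "2.prems" by blast
    then show ?thesis using augments_Cons f by (meson list.set_intros(2))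
  next
    case c: 2
    show ?thesis
    proof (cases "p = q \<and> bad_step q x a b")
      case False
      then have "\<not> bad_step q x b a" "\<not> bad_step q x a b" if "p = q"
        using that by (auto simp: bad_step_def)
      then have "augments r ((q, x, a, b) # ss)"
        using c 2(6,7) conflict_with_parent[OF T q f] conflict_with_parent[OF T q f']
          conflict_with_new[OF T q f] conflict_with_new[OF T q f'] sw by blast
      then show ?thesis ..
    qed auto
  next
    case 3
    then show ?thesis using augments_keep[OF frees_keeps_new[OF T q f 3(1,2)]] pp 2 ne by auto
  next
    case 4
    then show ?thesis using augments_keep[of r _ t p v] frees_keeps_sibling[OF T q f] pp 2 ne
      by (auto simp: doubleton_eq_iff)
  qed
qed auto

section \<open>Path partitions of minimal cost\<close>

fun comps :: "'v step list \<Rightarrow> 'v list multiset" where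
  "comps [] = {#}"
| "comps ((q, x, a, b) # ss) = add_mset (rev a @ [x] @ b) (comps ss)"

lemma comps_append [simp]: "comps (ss @ ss') = comps ss + comps ss'"
  by (induction ss rule: comps.induct) simp_all

lemma tverts_comps: "tverts r ss = mset r + vsum (comps ss)"
  by (induction r ss rule: tverts.induct) simp_all

lemma long_comps: "tree r ss \<Longrightarrow> p \<in># comps ss \<Longrightarrow> long p"
  by (induction r ss rule: tree.induct) (use long_fork in auto)

text \<open>The last two components of the cost serve only to exclude bad steps: the middle one forces
  the root of a tree with a bad step to be a single vertex, and the last one decreases when the triangle of a bad
  step is absorbed into a path on five vertices.\<close>

definition chorded :: "'v list \<Rightarrow> bool" where
  "chorded p \<longleftrightarrow> length p = 5 \<and> E (p ! 1) (p ! 3)"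

definition cost :: "'v list multiset \<Rightarrow> nat \<times> nat \<times> nat" where
  "cost N = (size {#p \<in># N. length p < 3#}, size {#p \<in># N. length p = 2#},
     size {#p \<in># N. \<not> chorded p#})"

definition better :: "'v list multiset \<Rightarrow> 'v list multiset \<Rightarrow> bool" where
  "better M N \<longleftrightarrow> (cost M, cost N) \<in> less_than <*lex*> less_than <*lex*> less_than"

text \<open>All three cost components are additive, so common paths do not affect the
  comparison.\<close>

lemma better_add: "better M N \<Longrightarrow> better (M + Q) (N + Q)"
  by (auto simp: better_def cost_def)

text \<open>The single multiset equation makes the lists repetition-free, pairwise disjoint and
  covering.\<close>

definition lpart :: "'v list multiset \<Rightarrow> bool" where
  "lpart ps \<longleftrightarrow> (\<forall>p\<in>#ps. lpath p) \<and> vsum ps = mset_set V"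

definition optimal :: "'v list multiset \<Rightarrow> bool" where
  "optimal ps \<longleftrightarrow> lpart ps \<and> (\<forall>qs. lpart qs \<longrightarrow> \<not> better qs ps)"

lemma ex_optimal: "\<exists>ps. optimal ps"
proof -
  have "vsum (image_mset (\<lambda>v. [v]) M) = M" for M
    by (induction M) simp_all
  \<comment> \<open>Single vertices give a first partition; well-foundedness of the cost order then
    gives a minimal one.\<close>
  then have ex: "lpart (image_mset (\<lambda>v. [v]) (mset_set V))"
    by (auto simp: lpart_def)
  have "wf (inv_image (less_than <*lex*> less_than <*lex*> less_than) cost)"
    by (intro wf_inv_image wf_lex_prod wf_less_than)
  from wfE_min[OF this, of _ "Collect lpart"] ex
  show ?thesis unfolding optimal_def better_def in_inv_image by (metis mem_Collect_eq)
qed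

lemma optimal_exchange:
  assumes "optimal (P + Q)" "\<forall>p\<in>#N. lpath p" "vsum N = vsum P"
  shows "\<not> better N P"
proof -
  have "lpart (N + Q)" using assms by (auto simp: optimal_def lpart_def)
  then show ?thesis using assms(1) better_add by (auto simp: optimal_def)
qed

lemma better_fewer_short:
  "size {#p \<in># M. length p < 3#} < size {#p \<in># N. length p < 3#} \<Longrightarrow> better M N"
  by (simp add: better_def cost_def)

lemma no_short: "\<forall>p\<in>#N. long p \<Longrightarrow> {#p \<in># N. length p < 3#} = {#}"
  "\<forall>p\<in>#N. long p \<Longrightarrow> {#p \<in># N. length p = 2#} = {#}"
  by (fastforce simp: long_def filter_mset_eq_conv)+

lemma long_lpath: "long p \<Longrightarrow> lpath p"
  by (simp add: long_def)

text \<open>The piece \<open>r\<close> counts in the first cost component, to which \<open>N\<close>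
  contributes nothing.\<close>

lemma optimal_no_long_cover:
  assumes opt: "optimal (add_mset r P + Q)" and r: "piece r" and N: "\<forall>p\<in>#N. long p"
    and "vsum N = mset r + vsum P"
  shows False
proof -
  have "better N (add_mset r P)"
    using N r by (intro better_fewer_short) (auto simp: no_short piece_def)
  then show False using optimal_exchange[OF opt, of N] assms long_lpath by auto
qed

lemma tree_root: "tree r ss \<Longrightarrow> piece r"
  by (induction r ss rule: tree.induct) auto

lemma optimal_no_augments:
  assumes "optimal (add_mset r (comps ss) + Q)" "tree r ss"
  shows "\<not> augments r ss"
  using optimal_no_long_cover[OF assms(1) tree_root[OF assms(2)]]
  by (metis augments_def tverts_comps)

section \<open>Absence of bad steps in an optimal partition\<close>

lemma step_split:
  assumes "tree r ss" "(q, x, a, b) \<in> set ss"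
  obtains ss1 ss2 where "ss = ss2 @ (q, x, a, b) # ss1" "tree r ss1" "q \<in> pieces r ss1" "fork q x a b"
proof -
  obtain ss1 ss2 where ss: "ss = ss2 @ (q, x, a, b) # ss1"
    using assms(2) by (meson split_list)
  have "tree r (ss2 @ ss') \<Longrightarrow> tree r ss'" for ss'
    by (induction ss2) auto
  then have "tree r ((q, x, a, b) # ss1)" using assms ss by blast
  then show ?thesis using that ss by auto
qed

lemma piece_origin:
  "p \<in> pieces r ss \<Longrightarrow> p = r \<or> (\<exists>q x a. (q, x, a, p) \<in> set ss \<or> (q, x, p, a) \<in> set ss)"
  by (induction r ss rule: pieces.induct) auto

lemma lpath_5: "lpath [u, v, w, x, y] \<longleftrightarrow> E u v \<and> E v w \<and> E w x \<and> E x y"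
  by (auto simp: lpath_def)

text \<open>The edge from \<open>last q\<close> to \<open>hd b\<close> closes a triangle with
  \<open>x\<close>. If \<open>a\<close> is a single vertex, the path
  \<open>[a1, x, l, b1, b2]\<close> runs through the triangle and covers \<open>C\<close>, so at
  most the first vertex of \<open>q\<close> must be placed elsewhere.\<close>

lemma not_bad_aux:
  assumes T: "tree r ss" and q: "q \<in> pieces r ss" and f: "fork q x a b"
    and b: "length b = 2" "E (last q) (hd b)" and C: "C = rev a @ [x] @ b \<or> C = rev b @ [x] @ a"
    and opt: "optimal (add_mset r (add_mset C (comps ss)) + Q)"
  shows False
proof -
  have pc: "piece q" "piece a" "piece b" "piece r"
    using tree_piece[OF T q] f tree_root[OF T] by (auto simp: fork_def)
  obtain b1 b2 where b12: "b = [b1, b2]" "E b1 b2"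
    using pc(3) b(1) by (auto elim!: piece_cases)
  obtain N where N: "\<forall>t\<in>#N. long t" "mset r + vsum (comps ss) = mset q + vsum N"
    using ex_frees[OF T q] by (auto simp: frees_def tverts_comps)
  have mC: "mset C = mset a + {#x#} + mset b" using C by auto
  have sumC: "mset r + vsum (add_mset C (comps ss)) = mset q + vsum N + mset a + {#x#} + mset b"
    using N(2) mC by (simp add: ac_simps)
  show False
    using pc(2)
  proof (cases rule: piece_cases)
    case (2 a1 a2)
    \<comment> \<open>With two vertices in \<open>a\<close>, the triangle edge joins
      \<open>q\<close> to \<open>b\<close>, and \<open>x # a\<close> is long by itself.\<close>
    have "long (q @ b)" "long (x # a)"
      using pc 2 b b12 f by (auto simp: long_def piece_def lpath_append lpath_ne lpath_Cons fork_def Suc_le_eq)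
    then show False
      using optimal_no_long_cover[OF opt pc(4), of "{#q @ b, x # a#} + N"] N(1) sumC
      by (simp add: ac_simps)
  next
    case a1: (1 a1)
    have C4: "length C = 4" using C a1 b12 by auto
    show False
      using pc(1)
    proof (cases rule: piece_cases)
      case (1 l)
      have "long [a1, x, l, b1, b2]"
        using 1 a1 b12 b f E_sym by (auto simp: long_def lpath_5 fork_def)
      then show False
        using optimal_no_long_cover[OF opt pc(4), of "{#[a1, x, l, b1, b2]#} + N"] N(1) sumC
          a1 b12 1 by (simp add: ac_simps)
    next
      case (2 c l)
      have P5: "long [a1, x, l, b1, b2]" "chorded [a1, x, l, b1, b2]"
        using 2 a1 b12 b f E_sym by (auto simp: long_def lpath_5 fork_def chorded_def)
      show False
      proof (cases "q = r")
        case True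
        \<comment> \<open>Freeing \<open>a\<close> makes a single vertex, instead of the two-vertex
          root, the only short path here: the second cost component drops.\<close>
        have lr: "length r = 2" unfolding True[symmetric] 2(1) by simp
        have "tree r ((q, x, a, b) # ss)" using T q f by simp
        from ex_frees[OF this, of a] obtain M where "frees r ((q, x, a, b) # ss) a M" by auto
        then have M: "\<forall>t\<in>#M. long t" "tverts r ((q, x, a, b) # ss) = mset a + vsum M"
          unfolding frees_def by blast+
        have "better (add_mset a M) (add_mset r (add_mset C (comps ss)))"
          using M(1) lr a1 C4 long_comps[OF T]
          by (simp add: better_def cost_def no_short)
        moreover have "vsum (add_mset a M) = vsum (add_mset r (add_mset C (comps ss)))"
          using M(2) mC by (simp add: tverts_comps ac_simps)
        ultimately show False
          using optimal_exchange[OF opt, of "add_mset a M"] M(1) long_lpath pc by (auto simp: piece_def)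
      next
        case False
        \<comment> \<open>Otherwise \<open>q\<close> comes from an earlier step, with cut vertex
          \<open>z\<close> and sibling \<open>s\<close>.\<close>
        then obtain q0 z s where st: "(q0, z, s, q) \<in> set ss \<or> (q0, z, q, s) \<in> set ss"
          using piece_origin[OF q] by auto
        obtain ss1 ss2 C' where ss: "comps ss = comps ss2 + add_mset C' (comps ss1)"
          "tree r ss1" "q0 \<in> pieces r ss1" "fork q0 z s q"
          and C': "C' = rev s @ [z] @ q \<or> C' = rev q @ [z] @ s"
          using st
        proof
          assume "(q0, z, s, q) \<in> set ss"
          from step_split[OF T this] obtain ss1 ss2 where
            "ss = ss2 @ (q0, z, s, q) # ss1" "tree r ss1" "q0 \<in> pieces r ss1" "fork q0 z s q" .
          then show ?thesis using that[of ss2 "rev s @ [z] @ q" ss1] by simp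
        next
          assume "(q0, z, q, s) \<in> set ss"
          from step_split[OF T this] obtain ss1 ss2 where
            "ss = ss2 @ (q0, z, q, s) # ss1" "tree r ss1" "q0 \<in> pieces r ss1" "fork q0 z q s" .
          then show ?thesis using that[of ss2 "rev q @ [z] @ s" ss1] by (simp add: fork_commute)
        qed
        obtain M where M: "\<forall>t\<in>#M. long t" "mset r + vsum (comps ss1) = mset q0 + vsum M"
          using ex_frees[OF ss(2,3)] by (auto simp: frees_def tverts_comps)
        have q0: "piece q0" "piece s" using tree_piece[OF ss(2,3)] ss(4) by (auto simp: fork_def)
        have mC': "mset C' = mset s + {#z#} + mset q" using C' by auto
        show False
        proof (cases "chorded C'")
          case True
          \<comment> \<open>The chord of \<open>C'\<close> joins \<open>c\<close> to
            \<open>s1\<close>. So the freed \<open>q0\<close> is extended by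
            \<open>[z, c, s1, s2]\<close>, and the five-vertex path covers everything else in
            \<open>C\<close> and \<open>C'\<close>.\<close>
          obtain s1 s2 where s: "s = [s1, s2]" "E c s1"
            using True C' 2 q0(2) E_sym by (auto simp: chorded_def nth_Cons' elim!: piece_cases)
          have L: "long (q0 @ [z, c, s1, s2])"
            using q0 s 2 ss(4) by (auto simp: long_def piece_def lpath_append lpath_Cons lpath_ne fork_def)
          have eq: "vsum ({#q0 @ [z, c, s1, s2], [a1, x, l, b1, b2]#} + M)
              = mset r + vsum (add_mset C (add_mset C' (comps ss1)))"
            using M(2) mC mC' s(1) a1 b12(1) 2(1) by (simp add: ac_simps)
          have "optimal (add_mset r (add_mset C (add_mset C' (comps ss1))) + (comps ss2 + Q))"
            using opt ss(1) by (simp add: ac_simps)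
          from optimal_no_long_cover[OF this pc(4) _ eq] show False
            using M(1) L P5(1) by auto
        next
          case nc: False
          \<comment> \<open>Moving \<open>l\<close> out of \<open>C'\<close> leaves a path on three
            or four vertices, again not chorded, and turns \<open>C\<close> into a chorded path:
            only the third cost component changes, and it drops.\<close>
          have lens: "length (rev s @ [z, c]) < 5" "3 \<le> length (rev s @ [z, c])" "3 \<le> length C'" "s \<noteq> []"
            using q0(2) C' 2 by (auto elim!: piece_cases)
          have "better {#rev s @ [z, c], [a1, x, l, b1, b2]#} {#C', C#}"
            using nc lens C4 P5(2) by (simp add: better_def cost_def chorded_def)
          moreover have "lpath (rev s @ [z, c])"
            using q0(2) ss(4) 2 E_sym by (auto simp: piece_def lpath_append lpath_Cons lpath_ne last_rev fork_def)
          moreover have "optimal ({#C', C#} + (add_mset r (comps ss1 + comps ss2) + Q))"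
            using opt ss(1) by (simp add: ac_simps add_mset_commute)
          note optimal_exchange[OF this, of "{#rev s @ [z, c], [a1, x, l, b1, b2]#}"]
          ultimately show False
            using P5(1) long_lpath mC mC' a1 b12(1) 2(1) by (simp add: ac_simps)
        qed
      qed
    qed
  qed
qed

text \<open>The tree is cut back to the stage just before the bad step; the paths of later steps
  count as lying outside.\<close>

lemma not_bad:
  assumes T: "tree r ss" and st: "(q, x, a, b) \<in> set ss" and opt: "optimal (add_mset r (comps ss) + Q)"
  shows "\<not> bad_step q x a b"
proof
  assume bad: "bad_step q x a b"
  obtain ss1 ss2 where ss: "ss = ss2 @ (q, x, a, b) # ss1" "tree r ss1" "q \<in> pieces r ss1" "fork q x a b"
    using step_split[OF T st] .
  have opt': "optimal (add_mset r (add_mset (rev a @ [x] @ b) (comps ss1)) + (comps ss2 + Q))"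
    using opt ss(1) by (simp add: ac_simps)
  show False
    using bad not_bad_aux[OF ss(2,3) _ _ _ _ opt'] ss(4)
    unfolding bad_step_def by (metis fork_commute)
qed

text \<open>Unless \<open>v\<close> splits \<open>C\<close> into two sides of one or two vertices
  each, freeing \<open>p\<close> and joining it to \<open>v\<close> lowers the number of short
  paths.\<close>

lemma outside_grows:
  assumes T: "tree r ss" and p: "p \<in> pieces r ss" and v: "v \<in> set C" "E (last p) v"
    and opt: "optimal (add_mset r (add_mset C (comps ss)) + Q)"
  shows "\<exists>a x b. C = rev a @ [x] @ b \<and> fork p x a b"
proof -
  have pc: "piece p" "piece r" using tree_piece[OF T p] tree_root[OF T] by auto
  then have lp: "lpath p" "p \<noteq> []" by (auto simp: piece_def lpath_ne)
  have C: "lpath C" using opt by (auto simp: optimal_def lpart_def)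
  obtain N where N: "\<forall>t\<in>#N. long t" "mset r + vsum (comps ss) = mset p + vsum N"
    using ex_frees[OF T p] by (auto simp: frees_def tverts_comps)
  have sumC: "mset r + vsum (add_mset C (comps ss)) = mset p + vsum N + mset C"
    using N(2) by (simp add: ac_simps)
  \<comment> \<open>At an end of \<open>C\<close> the freed \<open>p\<close> is simply joined on;
    this saves a short path whether or not \<open>C\<close> is short itself.\<close>
  have attach: False if D: "lpath D" "mset D = mset C" "hd D = v" for D
  proof -
    have pD: "lpath (p @ D)" using D lp v lpath_append lpath_ne by blast
    have lD: "length D = length C" using D by (metis size_mset)
    have "better (add_mset (p @ D) N) (add_mset r (add_mset C (comps ss)))"
      using pc N(1) long_comps[OF T] lD lp C lpath_ne[OF C]
      by (intro better_fewer_short) (auto simp: no_short piece_def Suc_le_eq neq_Nil_conv)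
    then show False
      using optimal_exchange[OF opt, of "add_mset (p @ D) N"] N(1) long_lpath pD sumC D(2)
      by (auto simp: ac_simps)
  qed
  obtain A B where AB: "C = A @ v # B" using v(1) by (meson split_list)
  have A: "A \<noteq> []" using attach[of C] AB C by auto
  have B: "B \<noteq> []" using attach[of "rev C"] AB C lpath_rev[of C] by (auto simp del: lpath_rev)
  have AvB: "lpath A" "lpath B" "E (last A) v" "E v (hd B)"
    using C AB A B by (auto simp: lpath_append lpath_Cons)
  \<comment> \<open>A side \<open>D2\<close> with at least three vertices is long by itself, and
    \<open>p\<close> takes \<open>v\<close> with the other side.\<close>
  have cut: False if D: "lpath D1" "lpath D2" "mset C = mset D1 + {#v#} + mset D2" "E v (hd D1)"
    "3 \<le> length D2" for D1 D2
  proof -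
    have "long D2" using D by (simp add: long_def)
    moreover have "long (p @ v # D1)"
      using D lp v lpath_append[of p "v # D1"] lpath_ne[OF D(1)]
      by (cases p; cases D1) (auto simp: long_def lpath_Cons lpath_ne Suc_le_eq)
    ultimately show False
      using optimal_no_long_cover[OF opt pc(2), of "{#p @ v # D1, D2#} + N"] N(1) sumC D(3)
      by (simp add: ac_simps)
  qed
  have "length A \<le> 2" using cut[of B A] AvB AB by (cases "3 \<le> length A") auto
  moreover have "length B \<le> 2"
    using cut[of "rev A" B] AvB AB A E_sym by (cases "3 \<le> length B") (auto simp: hd_rev)
  ultimately have "fork p v (rev A) B"
    using AvB A v E_sym by (simp add: fork_def piece_def hd_rev)
  then show ?thesis using AB by (intro exI[of _ "rev A"] exI[of _ v] exI[of _ B]) simp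
qed

section \<open>Growing ends and cut vertices of a maximal tree as a barrier\<close>

fun leaves :: "'v list \<Rightarrow> 'v step list \<Rightarrow> 'v multiset" where
  "leaves r [] = {#last r#}"
| "leaves r ((q, x, a, b) # ss) = {#last a, last b#} + leaves r ss"

fun centers :: "'v step list \<Rightarrow> 'v multiset" where
  "centers [] = {#}"
| "centers ((q, x, a, b) # ss) = add_mset x (centers ss)"

lemma set_leaves: "set_mset (leaves r ss) = last ` pieces r ss"
  by (induction r ss rule: leaves.induct) auto

lemma size_leaves: "size (leaves r ss) = 2 * size (centers ss) + 1"
  by (induction r ss rule: leaves.induct) auto

text \<open>As a multiset statement it also yields, once \<open>tverts r ss\<close> lies below
  \<open>mset_set V\<close>, that all growing ends and cut vertices are distinct.\<close>

lemma leaves_centers_subset: "tree r ss \<Longrightarrow> leaves r ss + centers ss \<subseteq># tverts r ss"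
proof (induction r ss rule: tree.induct)
  case (1 r)
  then show ?case by (simp add: piece_def lpath_ne)
next
  case (2 r q x a b ss)
  then have "{#last a#} \<subseteq># mset a" "{#last b#} \<subseteq># mset b" "leaves r ss + centers ss \<subseteq># tverts r ss"
    by (auto simp: fork_def piece_def lpath_ne)
  then have "{#last a#} + {#x#} + {#last b#} + (leaves r ss + centers ss)
      \<subseteq># mset a + {#x#} + mset b + tverts r ss"
    by (intro subset_mset.add_mono) auto
  then show ?case by (simp add: ac_simps)
qed

lemma tverts_cover: "v \<in># tverts r ss \<Longrightarrow> v \<in># centers ss \<or> (\<exists>p\<in>pieces r ss. v \<in> set p)"
  by (induction r ss rule: tverts.induct) auto

lemma subset_mset_set:
  assumes "M \<subseteq># mset_set V"
  shows "card (set_mset M) = size M" "count M v \<le> 1" "set_mset M \<subseteq> V"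
proof -
  have c: "count M v \<le> 1" for v
    using mset_subset_eq_count[OF assms, of v] by (auto simp: count_mset_set' split: if_splits)
  show "count M v \<le> 1" by (rule c)
  have "M = mset_set (set_mset M)"
    by (rule multiset_eqI) (use c in \<open>auto simp: count_mset_set' le_Suc_eq count_eq_zero_iff\<close>)
  then have "size M = size (mset_set (set_mset M))" by (rule arg_cong)
  then show "card (set_mset M) = size M" by simp
  show "set_mset M \<subseteq> V" using set_mset_mono[OF assms] finite_V by simp
qed

text \<open>By \<open>frees_keeps_cases\<close> both pieces occur side by side in one decomposition
  of \<open>tverts r ss\<close>, so a common vertex would have multiplicity at least two.\<close>

lemma pieces_disjoint:
  assumes "tree r ss" "tverts r ss \<subseteq># mset_set V" "p \<in> pieces r ss" "t \<in> pieces r ss" "p \<noteq> t"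
  shows "set p \<inter> set t = {}"
proof -
  have "mset p + mset t \<subseteq># tverts r ss"
    using frees_keeps_cases[OF assms(1,3,4,5)]
    by (auto simp: frees_keeps_def frees_def ac_simps)
  then have "mset p + mset t \<subseteq># mset_set V" using assms(2) by (rule subset_mset.order_trans)
  note le = subset_mset_set(2)[OF this, unfolded count_union]
  show ?thesis
  proof (rule ccontr)
    assume "set p \<inter> set t \<noteq> {}"
    then obtain v where "v \<in> set p" "v \<in> set t" by blast
    then have "0 < count (mset p) v" "0 < count (mset t) v" by simp_all
    then show False using le[of v] by linarith
  qed
qed

text \<open>The assumption says that every component has at least three vertices. \<open>X\<close>
  will be the cut vertices and \<open>L\<close> the growing ends of a maximal tree.\<close>

theorem long_path_partition_or_barrier:
  assumes big: "\<forall>v\<in>V. \<exists>u. E v u \<and> (\<exists>w. w \<noteq> u \<and> E v w \<or> w \<noteq> v \<and> E u w)"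
  shows "(\<exists>ps. lpart ps \<and> (\<forall>p\<in>#ps. 3 \<le> length p)) \<or>
    (\<exists>X L. X \<subseteq> V \<and> L \<subseteq> V \<and> X \<noteq> {} \<and> card L = 2 * card X + 1 \<and>
      (\<forall>u\<in>L. \<forall>v\<in>L. \<not> E u v) \<and> (\<forall>u\<in>L. card ({v. E u v} - X) \<le> 1))"
proof -
  obtain ps0 where ps0: "optimal ps0" using ex_optimal by blast
  show ?thesis
  proof (cases "\<forall>p\<in>#ps0. 3 \<le> length p")
    case True
    then show ?thesis using ps0 optimal_def by blast
  next
    case False
    then obtain r0 R0 where R0: "ps0 = add_mset r0 R0" "length r0 < 3"
      by (meson mset_add not_le)
    then have r0: "piece r0" using ps0 by (simp add: optimal_def lpart_def piece_def)
    have in_V: "set r0 \<subseteq> V"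
    proof -
      have "mset r0 + vsum R0 = mset_set V" using ps0 R0 by (simp add: optimal_def lpart_def)
      then have "mset r0 \<subseteq># mset_set V" by (metis mset_subset_eq_add_left)
      then show ?thesis using subset_mset_set(3) by fastforce
    qed
    \<comment> \<open>The root is oriented so that its growing end has a neighbour outside it; this
      makes \<open>X\<close> nonempty later.\<close>
    obtain r where r: "piece r" "mset r = mset r0" "\<exists>w. E (last r) w \<and> w \<notin> set r"
      using r0
    proof (cases rule: piece_cases)
      case (1 x)
      then show ?thesis using that[of "[x]"] bspec[OF big, of x] in_V E_irrefl r0 by auto
    next
      case (2 x y)
      obtain w where "w \<noteq> y \<and> E x w \<or> w \<noteq> x \<and> E y w"
        using bspec[OF big, of x] bspec[OF big, of y] 2 in_V E_sym E_irrefl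
        by (metis insert_subset list.simps(15))
      then show ?thesis
      proof
        assume "w \<noteq> y \<and> E x w"
        moreover from this have "w \<noteq> x" using E_irrefl by blast
        ultimately show ?thesis using that[of "[y, x]"] 2 E_sym
          by (fastforce simp: piece_def lpath_def)
      next
        assume "w \<noteq> x \<and> E y w"
        moreover from this have "w \<noteq> y" using E_irrefl by blast
        ultimately show ?thesis using that[of "[x, y]"] 2
          by (fastforce simp: piece_def lpath_def)
      qed
    qed
    define ps where "ps = add_mset r R0"
    \<comment> \<open>Reorienting the root keeps its length, and only five-vertex lists can be
      chorded, so the cost is unchanged.\<close>
    have "length r = length r0" using r(2) by (metis size_mset)
    then have "cost ps = cost ps0"
      using R0 by (simp add: ps_def cost_def chorded_def)
    then have ps: "optimal ps"
      using ps0 R0 r by (auto simp: optimal_def better_def lpart_def piece_def ps_def)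
    define grown where "grown n \<longleftrightarrow> (\<exists>ss Q. length ss = n \<and> tree r ss \<and> ps = add_mset r (comps ss) + Q)" for n
    have "length ss = size (comps ss)" for ss :: "'v step list"
      by (induction ss rule: comps.induct) auto
    then have bound: "\<forall>n. grown n \<longrightarrow> n \<le> size ps" by (auto simp: grown_def)
    have "grown 0" using r(1) by (auto simp: grown_def ps_def intro: exI[of _ "[]"])
    \<comment> \<open>A largest tree exists because each step uses up a path of
      \<open>ps\<close>.\<close>
    then have "\<exists>n. grown n \<and> (\<forall>m. grown m \<longrightarrow> m \<le> n)"
      using ex_has_greatest_nat[where P = grown and f = id and b = "Suc (size ps)"] bound
      by (auto simp: less_Suc_eq_le)
    then obtain n where n: "grown n" "\<And>m. grown m \<Longrightarrow> m \<le> n" by blast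
    obtain ss Q where ss: "length ss = n" "tree r ss" "ps = add_mset r (comps ss) + Q"
      using n(1) by (auto simp: grown_def)
    have opt: "optimal (add_mset r (comps ss) + Q)" using ps ss by simp
    have V: "tverts r ss + vsum Q = mset_set V"
      using opt by (simp add: optimal_def lpart_def tverts_comps ac_simps)
    then have tV: "tverts r ss \<subseteq># mset_set V" by (metis mset_subset_eq_add_left)
    \<comment> \<open>A neighbour in another piece would give an augmentation or a bad step; one
      outside the tree would allow a further step, against maximality.\<close>
    have nbrs: "v \<in># centers ss \<or> v \<in> set p" if p: "p \<in> pieces r ss" "E (last p) v" for p v
    proof (rule ccontr)
      assume neg: "\<not> (v \<in># centers ss \<or> v \<in> set p)"
      have "v \<in># mset_set V" using p E_sym E_in_V finite_V by auto
      then have "v \<in># tverts r ss \<or> v \<in># vsum Q" using V by (metis union_iff)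
      then show False
      proof
        assume "v \<in># tverts r ss"
        then obtain t where "t \<in> pieces r ss" "v \<in> set t" "t \<noteq> p"
          using tverts_cover neg by blast
        then show False
          using conflict[OF ss(2) p(1)] p(2) optimal_no_augments[OF opt ss(2)] not_bad[OF ss(2) _ opt]
          by blast
      next
        assume "v \<in># vsum Q"
        then obtain C where C: "C \<in># Q" "v \<in> set C" by (auto simp: vsum_def)
        then obtain Q' where Q': "Q = add_mset C Q'" by (meson mset_add)
        have "optimal (add_mset r (add_mset C (comps ss)) + Q')" using opt Q' by (simp add: add_mset_commute)
        from outside_grows[OF ss(2) p(1) C(2) p(2) this]
        obtain a x b where "C = rev a @ [x] @ b" "fork p x a b" by blast
        then have "grown (Suc n)" unfolding grown_def using ss Q' p
          by (intro exI[of _ "(p, x, a, b) # ss"] exI[of _ Q']) simp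
        then show False using n(2) by fastforce
      qed
    qed
    have sub: "leaves r ss + centers ss \<subseteq># mset_set V"
      using leaves_centers_subset[OF ss(2)] tV by (rule subset_mset.order_trans)
    have subL: "leaves r ss \<subseteq># mset_set V" and subX: "centers ss \<subseteq># mset_set V"
      using sub subset_mset.order_trans[OF mset_subset_eq_add_left]
        subset_mset.order_trans[OF mset_subset_eq_add_right] by blast+
    have disj: "v \<notin># centers ss" if "v \<in># leaves r ss" for v
    proof
      assume "v \<in># centers ss"
      then have "0 < count (leaves r ss) v" "0 < count (centers ss) v"
        using that by simp_all
      then show False
        using subset_mset_set(2)[OF sub, of v] unfolding count_union by linarith
    qed
    show ?thesis
    proof (rule disjI2, rule exI[of _ "set_mset (centers ss)"], rule exI[of _ "set_mset (leaves r ss)"],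
        intro conjI ballI)
      show "set_mset (centers ss) \<subseteq> V" "set_mset (leaves r ss) \<subseteq> V"
        using subset_mset_set(3) subL subX by auto
      show "card (set_mset (leaves r ss)) = 2 * card (set_mset (centers ss)) + 1"
        by (simp add: subset_mset_set(1)[OF subL] subset_mset_set(1)[OF subX] size_leaves)
      have "r \<in> pieces r ss" by (induction r ss rule: pieces.induct) auto
      then show "set_mset (centers ss) \<noteq> {}" using r(3) nbrs by fastforce
    next
      fix u v assume u: "u \<in># leaves r ss" and v: "v \<in># leaves r ss"
      obtain p where p: "p \<in> pieces r ss" "u = last p" using u by (auto simp: set_leaves)
      obtain t where t: "t \<in> pieces r ss" "v = last t" using v by (auto simp: set_leaves)
      have "v \<in> set t" using t tree_piece[OF ss(2)] by (auto simp: piece_def lpath_ne)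
      then show "\<not> E u v"
        using nbrs[OF p(1), of v] disj[OF v] pieces_disjoint[OF ss(2) tV p(1) t(1)] p t E_irrefl
        by auto
    next
      fix u assume u: "u \<in># leaves r ss"
      obtain p where p: "p \<in> pieces r ss" "u = last p" using u by (auto simp: set_leaves)
      \<comment> \<open>Outside \<open>X\<close> only the other vertex of the same piece
        remains.\<close>
      have "card ({v. E u v} - set_mset (centers ss)) \<le> card (set p - {last p})"
        using nbrs[OF p(1)] p(2) E_irrefl by (intro card_mono) auto
      also have "\<dots> \<le> 1"
        using tree_piece[OF ss(2) p(1)] by (cases rule: piece_cases) (auto simp: insert_Diff_if)
      finally show "card ({v. E u v} - set_mset (centers ss)) \<le> 1" .
    qed
  qed
qed

end


section \<open>Splitting the prescribed edge\<close>

lemma image_mset_vsum: "image_mset f (vsum N) = vsum (image_mset (map f) N)"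
  by (induction N) simp_all

text \<open>The edge \<open>cd\<close> is replaced by pendant vertices \<open>Inr True\<close> at \<open>c\<close> and \<open>Inr False\<close> at \<open>d\<close>.
  In a partition into long paths both are ends of paths, and deleting them lets \<open>cd\<close> be put back.\<close>

fun split_edge :: "('v \<Rightarrow> 'v \<Rightarrow> bool) \<Rightarrow> 'v \<Rightarrow> 'v \<Rightarrow> 'v + bool \<Rightarrow> 'v + bool \<Rightarrow> bool" where
  "split_edge E c d (Inl u) (Inl v) \<longleftrightarrow> E u v \<and> {u, v} \<noteq> {c, d}"
| "split_edge E c d (Inl u) (Inr b) \<longleftrightarrow> u = (if b then c else d)"
| "split_edge E c d (Inr b) (Inl u) \<longleftrightarrow> u = (if b then c else d)"
| "split_edge E c d (Inr b) (Inr b') \<longleftrightarrow> False"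

definition split_verts :: "'v set \<Rightarrow> ('v + bool) set" where
  "split_verts V = Inl ` V \<union> range Inr"

context finite_simple_relation
begin

lemma finite_nbrs: "finite {w. E v w}"
  using E_in_V E_sym by (intro finite_subset[OF _ finite_V]) blast

lemma split_edge_relation:
  assumes "E c d"
  shows "finite_simple_relation (split_verts V) (split_edge E c d)"
proof
  have cd: "c \<in> V" "d \<in> V" using assms E_sym E_in_V by blast+
  show "finite (split_verts V)" using finite_V by (simp add: split_verts_def)
  show "u \<in> split_verts V" if "split_edge E c d u v" for u v
    using that cd E_in_V by (cases u; cases v) (auto simp: split_verts_def)
  show "split_edge E c d v u" if "split_edge E c d u v" for u v
    using that E_sym by (cases u; cases v) (auto simp: insert_commute)
  show "\<not> split_edge E c d u u" for u
    using E_irrefl by (cases u) auto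
qed

lemma split_edge_Inl: "l \<notin> {c, d} \<Longrightarrow> split_edge E c d (Inl l) v \<longleftrightarrow> (\<exists>w. v = Inl w \<and> E l w)"
  by (cases v) auto

section \<open>Double counting against a barrier\<close>

lemma count_star_edges:
  assumes fin: "finite X" "finite L"
    and up: "\<And>x. x \<in> X \<Longrightarrow> card {l \<in> L. E x l} \<le> s"
    and low: "\<And>l. l \<in> L \<Longrightarrow> k \<le> card {x \<in> X. E l x}"
  shows "card L * k \<le> s * card X"
proof -
  have "card L * k \<le> (\<Sum>l\<in>L. card {x \<in> X. E l x})"
    using sum_mono[of L "\<lambda>_. k"] low by simp
  also have "\<dots> = (\<Sum>x\<in>X. card {l \<in> L. E l x})"
    using sum_multicount_gen[OF fin(2) fin(1), of E "\<lambda>x. card {l \<in> L. E l x}"] by simp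
  also have "\<dots> = (\<Sum>x\<in>X. card {l \<in> L. E x l})"
    using E_sym by (intro sum.cong refl arg_cong[of _ _ card]) blast
  also have "\<dots> \<le> s * card X"
    using sum_mono[of X _ "\<lambda>_. s"] up by (simp add: mult.commute)
  finally show ?thesis .
qed

lemma no_barrier:
  fixes X L :: "('v + bool) set"
  assumes cd: "E c d" and r: "r \<ge> 3"
    and deg: "\<forall>v\<in>V. r div 2 + 2 \<le> card {w. E v w}"
    and star: "\<forall>x S. S \<subseteq> {w. E x w} \<and> (\<forall>u\<in>S. \<forall>v\<in>S. \<not> E u v) \<longrightarrow> card S < r"
    and XL: "X \<subseteq> split_verts V" "L \<subseteq> split_verts V" "X \<noteq> {}" "card L = 2 * card X + 1"
    and indep: "\<forall>u\<in>L. \<forall>v\<in>L. \<not> split_edge E c d u v"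
    and out: "\<forall>u\<in>L. card ({v. split_edge E c d u v} - X) \<le> 1"
  shows False
proof -
  interpret S: finite_simple_relation "split_verts V" "split_edge E c d"
    by (rule split_edge_relation[OF cd])
  have fin: "finite X" "finite L" using XL S.finite_V finite_subset by blast+
  \<comment> \<open>Only original vertices are kept, and \<open>L1\<close> avoids \<open>c\<close>
    and \<open>d\<close>, whose neighbourhoods were changed.\<close>
  define X1 where "X1 = {x. Inl x \<in> X}"
  define L1 where "L1 = {l. Inl l \<in> L} - {c, d}"
  have iX: "Inl ` X1 \<subseteq> X" and iL: "Inl ` L1 \<subseteq> L" by (auto simp: X1_def L1_def)
  have finX1: "finite X1" using finite_subset[OF iX fin(1)] by (simp add: finite_image_iff)
  have finL1: "finite L1" using finite_subset[OF iL fin(2)] by (simp add: finite_image_iff)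
  have cX1: "card X1 \<le> card X" using card_mono[OF fin(1) iX] by (simp add: card_image)
  \<comment> \<open>A pendant vertex and its neighbour are adjacent, so the independent set
    \<open>L\<close> contains at most one of them. Passing to \<open>L1\<close> thus loses at most
    two elements.\<close>
  have one: "card ({Inl (if b then c else d), Inr b} \<inter> L) \<le> 1" for b
  proof -
    have "\<not> {Inl (if b then c else d), Inr b} \<subseteq> L"
      using indep by fastforce
    then have "{Inl (if b then c else d), Inr b} \<inter> L \<subseteq> {Inl (if b then c else d)}
        \<or> {Inl (if b then c else d), Inr b} \<inter> L \<subseteq> {Inr b}" by blast
    then show ?thesis using card_mono[of "{_}"] by fastforce
  qed
  have "L \<subseteq> Inl ` L1 \<union> (({Inl c, Inr True} \<inter> L) \<union> ({Inl d, Inr False} \<inter> L))"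
  proof
    fix v assume "v \<in> L"
    then show "v \<in> Inl ` L1 \<union> (({Inl c, Inr True} \<inter> L) \<union> ({Inl d, Inr False} \<inter> L))"
      by (cases v) (auto simp: L1_def)
  qed
  then have "card L \<le> card (Inl ` L1 \<union> (({Inl c, Inr True} \<inter> L) \<union> ({Inl d, Inr False} \<inter> L)))"
    using finL1 fin by (intro card_mono) auto
  also have "\<dots> \<le> card (Inl ` L1 :: ('v + bool) set)
      + (card ({Inl c, Inr True} \<inter> L) + card ({Inl d, Inr False} \<inter> L))"
    by (meson card_Un_le add_left_mono order_trans)
  also have "\<dots> \<le> card L1 + 2"
    using one[of True] one[of False] by (simp add: card_image)
  finally have cL: "2 * card X \<le> card L1 + 1" using XL by simp
  define h where "h = r div 2 + 1"
  \<comment> \<open>Away from \<open>c\<close> and \<open>d\<close> no edge was deleted, and at most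
    one of the at least \<open>h + 1\<close> neighbours lies outside \<open>X\<close>.\<close>
  have low: "h \<le> card {x \<in> X1. E l x}" if l: "l \<in> L1" for l
  proof -
    have lL: "Inl l \<in> L" and lcd: "l \<notin> {c, d}" using l by (auto simp: L1_def)
    have "Inl ` ({w. E l w} - X1) = {v. split_edge E c d (Inl l) v} - X"
      using lcd by (auto simp: split_edge_Inl X1_def)
    then have "card ({w. E l w} - X1) \<le> 1"
      using bspec[OF out lL] card_image[of "Inl :: 'v \<Rightarrow> 'v + bool" "{w. E l w} - X1"] by simp
    moreover have "card {w. E l w} = card ({w. E l w} - X1) + card {x \<in> X1. E l x}"
    proof -
      have "{w. E l w} = ({w. E l w} - X1) \<union> {x \<in> X1. E l x}" by blast
      moreover have "card (({w. E l w} - X1) \<union> {x \<in> X1. E l x})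
          = card ({w. E l w} - X1) + card {x \<in> X1. E l x}"
        using finite_nbrs[of l] finX1 by (intro card_Un_disjoint) auto
      ultimately show ?thesis by simp
    qed
    moreover have "l \<in> V" using lL XL(2) by (auto simp: split_verts_def)
    ultimately show ?thesis using bspec[OF deg, of l] by (simp add: h_def)
  qed
  \<comment> \<open>Members of \<open>L1\<close> keep all their edges, so \<open>L1\<close> is
    independent for \<open>E\<close> as well and the star condition applies.\<close>
  have up: "card {l \<in> L1. E x l} \<le> r - 1" for x
  proof -
    have "\<not> E u v" if "u \<in> L1" "v \<in> L1" for u v
    proof -
      have "Inl u \<in> L" "Inl v \<in> L" and u: "u \<notin> {c, d}"
        using that by (auto simp: L1_def)
      with indep have "\<not> split_edge E c d (Inl u) (Inl v)" by blast
      then show ?thesis using split_edge_Inl[OF u] by blast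
    qed
    then have "card {l \<in> L1. E x l} < r" by (intro star[rule_format]) auto
    then show ?thesis by simp
  qed
  have *: "card L1 * h \<le> (r - 1) * card X1"
    by (rule count_star_edges[OF finX1 finL1 up low])
  have "1 \<le> card X" using XL(3) fin(1) by (simp add: Suc_le_eq card_gt_0_iff)
  then have "L1 \<noteq> {}" using cL by auto
  then obtain l where "l \<in> L1" by blast
  then have hX: "h \<le> card X1"
    using low[of l] card_mono[OF finX1, of "{x \<in> X1. E l x}"] by force
  have "2 * card X1 * h \<le> (card L1 + 1) * h"
    using cL cX1 by (intro mult_le_mono1) simp
  \<comment> \<open>For either parity \<open>r - 1\<close> is at most \<open>2 * (r div 2)\<close>,
    which equals \<open>2 * (h - 1)\<close>; the products with \<open>h\<close> then cancel.\<close>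
  moreover have "(r - 1) * card X1 \<le> 2 * (r div 2) * card X1"
    by (intro mult_le_mono1) simp
  ultimately have "2 * card X1 * h \<le> 2 * (r div 2) * card X1 + h"
    using * unfolding add_mult_distrib mult_1 by linarith
  then have "2 * card X1 \<le> h" by (simp add: h_def algebra_simps)
  then show False using hX by (simp add: h_def)
qed

section \<open>Putting the prescribed edge back\<close>

lemma lpath_pendant:
  assumes "lpath p" "distinct p" "3 \<le> length p" "x \<in> set p" and only: "\<And>w. E x w \<Longrightarrow> w = y"
  shows "\<exists>B. B \<noteq> [] \<and> lpath (x # y # B) \<and> mset p = mset (x # y # B)"
proof -
  have front: ?thesis if q: "lpath (x # D)" "mset p = mset (x # D)" for D
  proof -
    have "length (x # D) = length p" using q(2) by (metis size_mset)
    then obtain w w' B where "D = w # w' # B"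
      using assms(3) by (cases D; cases "tl D") auto
    then show ?thesis using q only[of w] by (auto simp: lpath_Cons)
  qed
  obtain A D where AD: "p = A @ x # D" using assms(4) by (meson split_list)
  show ?thesis
  proof (cases "A = [] \<or> D = []")
    case True
    then show ?thesis using AD front[of D] front[of "rev A"] assms(1) lpath_rev[of p]
      by (auto simp del: lpath_rev)
  next
    case False
    then have "E (last A) x" "E x (hd D)"
      using assms(1) AD by (auto simp: lpath_append lpath_Cons)
    \<comment> \<open>At an inner position \<open>x\<close> would have \<open>y\<close> on both
      sides, so \<open>y\<close> would be repeated.\<close>
    then have "last A = hd D" using only E_sym by metis
    then have "hd D \<in> set A \<inter> set D" using False by (metis IntI last_in_set list.set_sel(1))
    then show ?thesis using assms(2) AD by auto
  qed
qed

lemma lpart_distinct: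
  assumes "lpart ps" "p \<in># ps"
  shows "distinct p"
proof -
  obtain qs where "ps = add_mset p qs" using assms(2) by (meson mset_add)
  then have "mset p + vsum qs = mset_set V" using assms(1) by (simp add: lpart_def)
  then have "mset p \<subseteq># mset_set V" by (metis mset_subset_eq_add_left)
  from subset_mset_set(2)[OF this] have "count (mset p) v \<le> 1" for v .
  then show ?thesis
    by (simp add: distinct_count_atmost_1 le_Suc_eq)
qed

lemma lpart_disjoint:
  assumes "lpart ps" "p \<in># ps" "q \<in># ps" "v \<in> set p" "v \<in> set q"
  shows "p = q"
proof (rule ccontr)
  assume "p \<noteq> q"
  obtain ps1 where ps1: "ps = add_mset p ps1" using assms(2) by (meson mset_add)
  then have "q \<in># ps1" using assms(3) \<open>p \<noteq> q\<close> by simp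
  then obtain ps2 where "ps1 = add_mset q ps2" by (meson mset_add)
  then have "(mset p + mset q) + vsum ps2 = mset_set V"
    using assms(1) ps1 by (simp add: lpart_def ac_simps)
  then have "mset p + mset q \<subseteq># mset_set V" by (metis mset_subset_eq_add_left)
  from subset_mset_set(2)[OF this, of v] have "count (mset p) v + count (mset q) v \<le> 1" by simp
  moreover have "0 < count (mset p) v" "0 < count (mset q) v" using assms(4,5) by simp_all
  ultimately show False by linarith
qed

theorem long_lpart_through_edge:
  assumes cd: "E c d" and r: "r \<ge> 3"
    and deg: "\<forall>v\<in>V. r div 2 + 2 \<le> card {w. E v w}"
    and star: "\<forall>x S. S \<subseteq> {w. E x w} \<and> (\<forall>u\<in>S. \<forall>v\<in>S. \<not> E u v) \<longrightarrow> card S < r"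
  shows "\<exists>ps. lpart ps \<and> (\<forall>p\<in>#ps. 3 \<le> length p) \<and> (\<exists>A B. A @ [c, d] @ B \<in># ps)"
proof -
  interpret S: finite_simple_relation "split_verts V" "split_edge E c d"
    by (rule split_edge_relation[OF cd])
  have cdV: "c \<noteq> d" "c \<in> V" "d \<in> V" using cd E_irrefl E_in_V E_sym by blast+
  \<comment> \<open>There are at least three neighbours, and deleting \<open>cd\<close> costs at
    most one.\<close>
  have two: "\<exists>u w. u \<noteq> w \<and> split_edge E c d (Inl a) (Inl u) \<and> split_edge E c d (Inl a) (Inl w)"
    if "a \<in> V" for a
  proof -
    define N where "N = {w. E a w} - {if a = c then d else c}"
    have "3 \<le> card {w. E a w}" using bspec[OF deg that] r by simp
    then have "2 \<le> card N" using finite_nbrs[of a] by (auto simp: N_def card_Diff_singleton_if)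
    then obtain u w where "u \<in> N" "w \<in> N" "u \<noteq> w"
    proof -
      have "finite N" using finite_nbrs[of a] by (simp add: N_def)
      moreover have "\<not> card N \<le> Suc 0" using \<open>2 \<le> card N\<close> by simp
      ultimately have "\<exists>u\<in>N. \<exists>w\<in>N. u \<noteq> w" using card_le_Suc0_iff_eq by blast
      then show ?thesis using that by blast
    qed
    then have "split_edge E c d (Inl a) (Inl u)" "split_edge E c d (Inl a) (Inl w)"
      using cdV by (auto simp: N_def doubleton_eq_iff split: if_splits)
    then show ?thesis using \<open>u \<noteq> w\<close> by blast
  qed
  have big: "\<forall>v\<in>split_verts V. \<exists>u. split_edge E c d v u \<and>
      (\<exists>w. w \<noteq> u \<and> split_edge E c d v w \<or> w \<noteq> v \<and> split_edge E c d u w)"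
  proof
    fix v assume v: "v \<in> split_verts V"
    show "\<exists>u. split_edge E c d v u \<and>
      (\<exists>w. w \<noteq> u \<and> split_edge E c d v w \<or> w \<noteq> v \<and> split_edge E c d u w)"
    proof (cases v)
      case (Inl a)
      then have "a \<in> V" using v by (auto simp: split_verts_def)
      from two[OF this] obtain u w where "u \<noteq> w" "split_edge E c d v (Inl u)" "split_edge E c d v (Inl w)"
        unfolding Inl by blast
      then show ?thesis by (intro exI[of _ "Inl u"] conjI exI[of _ "Inl w"]) auto
    next
      case (Inr b)
      have "(if b then c else d) \<in> V" using cdV by simp
      from two[OF this] obtain u where "split_edge E c d (Inl (if b then c else d)) (Inl u)" by blast
      then show ?thesis unfolding Inr
        by (intro exI[of _ "Inl (if b then c else d)"] conjI exI[of _ "Inl u"]) auto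
    qed
  qed
  obtain ps where ps: "S.lpart ps" "\<forall>p\<in>#ps. 3 \<le> length p"
  proof -
    from S.long_path_partition_or_barrier[OF big] show ?thesis
    proof (elim disjE exE conjE)
      fix ps assume "S.lpart ps" "\<forall>p\<in>#ps. 3 \<le> length p"
      then show ?thesis by (rule that)
    next
      fix X L assume "X \<subseteq> split_verts V" "L \<subseteq> split_verts V" "X \<noteq> {}" "card L = 2 * card X + 1"
        and "\<forall>u\<in>L. \<forall>v\<in>L. \<not> split_edge E c d u v"
        and "\<forall>u\<in>L. card ({v. split_edge E c d u v} - X) \<le> 1"
      then have False by (rule no_barrier[OF cd r deg star])
      then show ?thesis ..
    qed
  qed
  have sV: "mset_set (split_verts V) = image_mset Inl (mset_set V) + {#Inr True, Inr False#}"
  proof -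
    have "mset_set (range Inr :: ('v + bool) set) = {#Inr True, Inr False#}"
      by (simp add: UNIV_bool add_mset_commute)
    moreover have "mset_set (Inl ` V :: ('v + bool) set) = image_mset Inl (mset_set V)"
      by (simp add: image_mset_mset_set)
    ultimately show ?thesis
      unfolding split_verts_def using finite_V by (subst mset_set_Union) auto
  qed
  have proj: "lpath (map projl p)" if "S.lpath p" "set p \<subseteq> range Inl" for p
  proof -
    have E: "E (projl x) (projl y)" if "split_edge E c d x y" "x \<in> range Inl" "y \<in> range Inl" for x y
      using that by auto
    have "successively (\<lambda>x y. E (projl x) (projl y)) p"
      using that(1) unfolding S.lpath_def
      by (elim conjE successively_mono) (use that(2) E in blast)
    then show ?thesis using that by (simp add: S.lpath_def lpath_def successively_map)
  qed
  \<comment> \<open>Only the path through \<open>cd\<close> has to be supplied: by the vertex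
    equation the lists in \<open>rest\<close> avoid the pendant vertices and can be
    projected.\<close>
  have assemble: ?thesis
    if rest: "rest \<subseteq># ps" and new: "lpath new" "3 \<le> length new" "\<exists>A B. new = A @ [c, d] @ B"
      and sum: "vsum rest + image_mset Inl (mset new) = image_mset Inl (mset_set V)" for rest new
  proof -
    define qs where "qs = add_mset new (image_mset (map projl) rest)"
    have pJ: "image_mset projl (image_mset Inl M :: ('v + bool) multiset) = M" for M :: "'v multiset"
      by (simp add: multiset.map_comp comp_def)
    have "vsum qs = image_mset projl (vsum rest + image_mset Inl (mset new))"
      by (simp add: qs_def image_mset_vsum pJ)
    then have "vsum qs = mset_set V" unfolding sum pJ .
    moreover have "lpath (map projl p)" if p: "p \<in># rest" for p
    proof (rule proj)
      show "S.lpath p" using p rest ps(1) mset_subset_eqD by (fastforce simp: S.lpart_def)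
      have "set p \<subseteq> set_mset (vsum rest)" using p by (auto simp: vsum_def)
      also have "\<dots> \<subseteq> set_mset (vsum rest + image_mset Inl (mset new))" by simp
      also have "\<dots> \<subseteq> range Inl" unfolding sum by auto
      finally show "set p \<subseteq> range Inl" .
    qed
    ultimately have "lpart qs" using new by (auto simp: lpart_def qs_def)
    moreover have "\<forall>p\<in>#qs. 3 \<le> length p"
      using ps(2) rest new(2) mset_subset_eqD by (fastforce simp: qs_def)
    ultimately show ?thesis using new(3) unfolding qs_def by (metis union_single_eq_member)
  qed
  have pend: "\<exists>p B. p \<in># ps \<and> Inr b \<in> set p \<and> B \<noteq> [] \<and> distinct p \<and>
      S.lpath (Inr b # Inl (if b then c else d) # B) \<and>
      mset p = mset (Inr b # Inl (if b then c else d) # B)" for b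
  proof -
    have "Inr b \<in># vsum ps"
    proof -
      have "Inr b \<in> split_verts V" by (simp add: split_verts_def)
      then have "Inr b \<in># mset_set (split_verts V)" using S.finite_V by simp
      then show ?thesis using ps(1) by (simp add: S.lpart_def)
    qed
    then obtain p where p: "p \<in># ps" "Inr b \<in> set p" by (auto simp: vsum_def)
    have "S.lpath p" using p ps by (simp add: S.lpart_def)
    moreover have "w = Inl (if b then c else d)" if "split_edge E c d (Inr b) w" for w
      using that by (cases w) auto
    ultimately show ?thesis
      using S.lpath_pendant[of p "Inr b" "Inl (if b then c else d)"] S.lpart_distinct[OF ps(1) p(1)] p ps(2)
      by blast
  qed
  obtain p B where p: "p \<in># ps" "B \<noteq> []" "distinct p"
    "S.lpath (Inr True # Inl c # B)" "mset p = mset (Inr True # Inl c # B)" "Inr True \<in> set p"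
    using pend[of True] by auto
  obtain q D where q: "q \<in># ps" "D \<noteq> []" "distinct q"
    "S.lpath (Inr False # Inl d # D)" "mset q = mset (Inr False # Inl d # D)" "Inr False \<in> set q"
    using pend[of False] by auto
  have dB: "distinct (Inr True # Inl c # B)" using p(3,5) by (metis mset_eq_imp_distinct_iff)
  have dD: "distinct (Inr False # Inl d # D)" using q(3,5) by (metis mset_eq_imp_distinct_iff)
  have sp: "set p = set (Inr True # Inl c # B)" using p(5) by (rule mset_eq_setD)
  have sq: "set q = set (Inr False # Inl d # D)" using q(5) by (rule mset_eq_setD)
  obtain ps1 where ps1: "ps = add_mset p ps1" using p(1) by (meson mset_add)
  have tot: "vsum ps = image_mset Inl (mset_set V) + {#Inr True, Inr False#}"
    using ps(1) sV by (simp add: S.lpart_def)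
  have inv: "image_mset Inl (mset (map projl M)) = mset M"
    if "set M \<subseteq> range Inl" for M :: "('v + bool) list"
    using that by (induction M) auto
  show ?thesis
  proof (cases "p = q")
    case False
    then have "q \<in># ps1" using q(1) ps1 by simp
    then obtain ps2 where ps2: "ps1 = add_mset q ps2" by (meson mset_add)
    have Inl: "set (Inl c # B) \<subseteq> range Inl" "set (Inl d # D) \<subseteq> range Inl"
    proof -
      have "Inr False \<notin> set p" "Inr True \<notin> set q"
        using S.lpart_disjoint[OF ps(1) p(1) q(1)] p(6) q(6) False by blast+
      then have "Inr b \<notin> set B" "Inr b \<notin> set D" for b
        using dB dD sp sq by (cases b; simp)+
      then have "v \<in> range Inl" if "v \<in> set B \<union> set D" for v
        using that by (cases v rule: sum.exhaust) auto
      then show "set (Inl c # B) \<subseteq> range Inl" "set (Inl d # D) \<subseteq> range Inl" by auto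
    qed
    have "S.lpath (Inl c # B)" "S.lpath (Inl d # D)"
      using p(4) q(4) S.lpath_Cons by blast+
    then have l: "lpath (c # map projl B)" "lpath (d # map projl D)"
      using proj[OF _ Inl(1)] proj[OF _ Inl(2)] by auto
    \<comment> \<open>Without the pendant vertices one path starts at \<open>c\<close> and the other
      at \<open>d\<close>; the edge \<open>cd\<close> joins them.\<close>
    define new where "new = rev (c # map projl B) @ d # map projl D"
    have mB: "image_mset Inl (mset (map projl B)) = mset B" "image_mset Inl (mset (map projl D)) = mset D"
      using inv[of B] inv[of D] Inl by simp_all
    show ?thesis
    proof (rule assemble)
      show "ps2 \<subseteq># ps" by (simp add: ps1 ps2 subset_mset.add_increasing2 add_mset_commute)
      show "lpath new" unfolding new_def
        using l cd lpath_rev[of "c # map projl B"] by (subst lpath_append) (auto simp del: lpath_rev)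
      show "3 \<le> length new" using p(2) by (simp add: new_def Suc_le_eq)
      show "\<exists>A B. new = A @ [c, d] @ B"
        by (rule exI[of _ "rev (map projl B)"], rule exI[of _ "map projl D"]) (simp add: new_def)
      have "vsum ps2 + image_mset Inl (mset new) + {#Inr True, Inr False#} = vsum ps"
        using mB by (simp add: new_def ps1 ps2 p(5) q(5) add_mset_commute ac_simps)
      then show "vsum ps2 + image_mset Inl (mset new) = image_mset Inl (mset_set V)"
        unfolding tot by (rule add_right_imp_eq)
    qed
  next
    case True
    \<comment> \<open>Both pendant vertices are ends of the same path, which therefore runs from
      \<open>c\<close> to \<open>d\<close> between them.\<close>
    then have "Inr False \<in> set B" using q(6) sp by auto
    then obtain M D' where MD: "B = M @ Inr False # D'" by (meson split_list)
    have lM: "S.lpath ((Inr True # Inl c # M) @ Inr False # D')" using p(4) MD by simp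
    have "split_edge E c d (last (Inr True # Inl c # M)) (Inr False)"
      using lM by (subst (asm) S.lpath_append) auto
    then have lastM: "last (Inl c # M) = Inl d"
      by (cases "last (Inl c # M)") auto
    then have "M \<noteq> []" "last M = Inl d" using cdV by (auto split: if_splits)
    then obtain M' where M': "M = M' @ [Inl d]" by (metis append_butlast_last_id)
    have "D' = []"
    proof (rule ccontr)
      assume "D' \<noteq> []"
      then have "split_edge E c d (Inr False) (hd D')"
        using lM by (subst (asm) S.lpath_append) (auto simp: S.lpath_Cons)
      then have "hd D' = Inl d" by (cases "hd D'") auto
      then have "Inl d \<in> set D'" using \<open>D' \<noteq> []\<close> by (metis hd_in_set)
      then show False using dB MD M' by auto
    qed
    have lMd: "S.lpath (Inl c # M' @ [Inl d])"
      using lM M' S.lpath_append[of "Inr True # Inl c # M" "Inr False # D'"] by (simp add: S.lpath_Cons)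
    \<comment> \<open>The split relation lacks the edge \<open>cd\<close>, so \<open>c\<close> and
      \<open>d\<close> cannot be consecutive.\<close>
    have "M' \<noteq> []"
      using lMd by (auto simp: S.lpath_Cons)
    have rng: "set M \<subseteq> range Inl"
    proof
      fix v assume "v \<in> set M"
      moreover have "Inr b \<notin> set M" for b using dB MD by (cases b) auto
      ultimately show "v \<in> range Inl" by (cases v rule: sum.exhaust) auto
    qed
    have "S.lpath M" using lMd M' S.lpath_Cons by auto
    then have "lpath (rev (map projl M))" using proj rng by simp
    then have l: "lpath (d # rev (map projl M'))" by (simp add: M')
    \<comment> \<open>The edge \<open>cd\<close> closes \<open>c\<close>, \<open>M'\<close>,
      \<open>d\<close> to a cycle, which is opened between \<open>c\<close> and the first vertex of
      \<open>M'\<close>.\<close>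
    define new where "new = c # d # rev (map projl M')"
    have mM: "image_mset Inl (mset (map projl M')) = mset M'" using rng M' by (intro inv) auto
    show ?thesis
    proof (rule assemble)
      show "ps1 \<subseteq># ps" by (simp add: ps1)
      show "lpath new" unfolding new_def using l cd by (subst lpath_Cons) auto
      show "3 \<le> length new" using \<open>M' \<noteq> []\<close> by (simp add: new_def Suc_le_eq)
      show "\<exists>A B. new = A @ [c, d] @ B" 
        by (rule exI[of _ "[]"], rule exI[of _ "rev (map projl M')"]) (simp add: new_def)
      have "vsum ps1 + image_mset Inl (mset new) + {#Inr True, Inr False#} = vsum ps"
        using mM by (simp add: new_def ps1 p(5) MD M' \<open>D' = []\<close> add_mset_commute ac_simps)
      then show "vsum ps1 + image_mset Inl (mset new) = image_mset Inl (mset_set V)"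
        unfolding tot by (rule add_right_imp_eq)
    qed
  qed
qed

end

section \<open>From path partitions to path factors\<close>

definition consecutive :: "'a list \<Rightarrow> ('a \<times> 'a) set" where
  "consecutive p = {(u, v). \<exists>i. Suc i < length p \<and>
     (u = p ! i \<and> v = p ! Suc i \<or> u = p ! Suc i \<and> v = p ! i)}"

lemma consecutive_in_set: "(u, v) \<in> consecutive p \<Longrightarrow> u \<in> set p \<and> v \<in> set p"
  by (auto simp: consecutive_def)

lemma consecutive_sym: "(u, v) \<in> consecutive p \<Longrightarrow> (v, u) \<in> consecutive p"
  unfolding consecutive_def by blast

lemma consecutive_middle: "(c, d) \<in> consecutive (A @ [c, d] @ B)"
  unfolding consecutive_def by (auto intro!: exI[of _ "length A"] simp: nth_append)

context graph
begin

lemma dominates_relation: "finite_simple_relation (verts G) (dominates G)"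
  by unfold_locales (auto simp: adj_in_verts graph_symmetric dest: adj_not_same)

lemma consecutive_dominates:
  assumes "successively (dominates G) p" "(u, v) \<in> consecutive p"
  shows "u \<rightarrow>\<^bsub>G\<^esub> v"
  using assms graph_symmetric by (auto simp: consecutive_def successively_conv_nth)

lemma arcs_ends_restrict:
  "arc_to_ends G ` {a \<in> arcs G. arc_to_ends G a \<in> R} = arcs_ends G \<inter> R"
  by (auto simp: arcs_ends_def)

text \<open>Symmetry of \<open>R\<close> selects each arc together with its opposite.\<close>

lemma graph_of_symmetric_ends:
  assumes "subgraph H G" and ends: "arcs H = {a \<in> arcs G. arc_to_ends G a \<in> R}" "sym R"
  shows "graph H"
proof -
  interpret H: digraph H using digraph_subgraph[OF assms(1)] .
  have c: "tail H = tail G" "head H = head G"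
    using assms(1) by (auto simp: subgraph_def compatible_def)
  have "\<exists>e2\<in>arcs H. tail H e1 = head H e2 \<and> head H e1 = tail H e2" if e1: "e1 \<in> arcs H" for e1
  proof -
    have "tail G e1 \<rightarrow>\<^bsub>G\<^esub> head G e1" using e1 ends by (auto simp: arcs_ends_conv)
    then have "head G e1 \<rightarrow>\<^bsub>G\<^esub> tail G e1" by (rule graph_symmetric)
    then obtain e2 where "e2 \<in> arcs G" "tail G e2 = head G e1" "head G e2 = tail G e1" by auto
    moreover have "(head G e1, tail G e1) \<in> R"
      using e1 ends by (auto simp: arc_to_ends_def dest: symD)
    ultimately show ?thesis using ends(1) c by (intro bexI[of _ e2]) (auto simp: arc_to_ends_def)
  qed
  then show ?thesis by (intro H.graphI) (simp add: symmetric_conv)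
qed

definition list_graph :: "'a list \<Rightarrow> ('a, 'b) pre_digraph" where
  "list_graph p = \<lparr>verts = set p, arcs = {a \<in> arcs G. arc_to_ends G a \<in> consecutive p},
     tail = tail G, head = head G\<rparr>"

definition lists_graph :: "'a list multiset \<Rightarrow> ('a, 'b) pre_digraph" where
  "lists_graph ps = \<lparr>verts = verts G,
     arcs = {a \<in> arcs G. arc_to_ends G a \<in> (\<Union>p\<in>set_mset ps. consecutive p)},
     tail = tail G, head = head G\<rparr>"

lemma subgraph_lists_graph: "subgraph (lists_graph ps) G"
proof -
  have "wf_digraph (lists_graph ps)" by unfold_locales (auto simp: lists_graph_def)
  then show ?thesis using wf_digraph by (auto simp: subgraph_def compatible_def lists_graph_def)
qed

lemma graph_lists_graph: "graph (lists_graph ps)"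
proof (rule graph_of_symmetric_ends[OF subgraph_lists_graph])
  show "arcs (lists_graph ps) = {a \<in> arcs G. arc_to_ends G a \<in> (\<Union>p\<in>set_mset ps. consecutive p)}"
    by (simp add: lists_graph_def)
  show "sym (\<Union>p\<in>set_mset ps. consecutive p)"
    by (auto intro!: symI dest: consecutive_sym)
qed

lemma wf_list_graph: "wf_digraph (list_graph p)"
  by unfold_locales (auto simp: list_graph_def arc_to_ends_def dest: consecutive_in_set)

lemma subgraph_list_graph: "set p \<subseteq> verts G \<Longrightarrow> subgraph (list_graph p) G"
  using wf_list_graph[of p]
  by (auto simp: subgraph_def compatible_def list_graph_def wf_digraph)

lemma graph_list_graph: "set p \<subseteq> verts G \<Longrightarrow> graph (list_graph p)"
  by (rule graph_of_symmetric_ends[OF subgraph_list_graph, of p "consecutive p"])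
    (auto simp: list_graph_def intro!: symI dest: consecutive_sym)

lemma arcs_ends_list_graph:
  assumes "successively (dominates G) p"
  shows "arcs_ends (list_graph p) = consecutive p"
proof -
  have "arc_to_ends (list_graph p) = arc_to_ends G"
    by (rule ext) (simp add: arc_to_ends_def list_graph_def)
  then have "arcs_ends (list_graph p) = arcs_ends G \<inter> consecutive p"
    unfolding arcs_ends_restrict[symmetric] by (simp add: arcs_ends_def list_graph_def)
  then show ?thesis using consecutive_dominates[OF assms] by auto
qed

lemma connected_list_graph:
  assumes p: "set p \<subseteq> verts G" "successively (dominates G) p" "p \<noteq> []"
  shows "connected (list_graph p)"
proof -
  interpret P: graph "list_graph p" using graph_list_graph[OF p(1)] .
  have vP: "verts (list_graph p) = set p" by (simp add: list_graph_def)
  have r: "p ! 0 \<rightarrow>\<^sup>*\<^bsub>list_graph p\<^esub> p ! i" if "i < length p" for i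
    using that
  proof (induction i)
    case 0
    then show ?case by (simp add: vP)
  next
    case (Suc i)
    then have "p ! i \<rightarrow>\<^bsub>list_graph p\<^esub> p ! Suc i"
      unfolding arcs_ends_list_graph[OF p(2)] by (auto simp: consecutive_def)
    then show ?case using Suc P.reachable_adj_trans by simp
  qed
  have "u \<rightarrow>\<^sup>*\<^bsub>mk_symmetric (list_graph p)\<^esub> v" if uv: "u \<in> set p" "v \<in> set p" for u v
  proof (rule P.reachable_mk_symmetricI)
    obtain i j where "u = p ! i" "i < length p" "v = p ! j" "j < length p"
      using uv by (auto simp: in_set_conv_nth)
    then show "u \<rightarrow>\<^sup>*\<^bsub>list_graph p\<^esub> v"
      using P.reachable_trans[OF P.symmetric_reachable'[OF r] r] by simp
  qed
  then show ?thesis using p(3) by (auto simp: connected_def strongly_connected_def vP)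
qed

text \<open>The paths are disjoint, so no arc of their union leaves the path \<open>p\<close> that
  \<open>C\<close> meets. Being connected, \<open>C\<close> lies in \<open>list_graph p\<close>, and
  maximality gives equality.\<close>

lemma component_of_lists_graph:
  assumes ps: "finite_simple_relation.lpart (verts G) (dominates G) ps"
    and C: "C \<in> components (lists_graph ps)"
  shows "\<exists>p\<in>#ps. C = list_graph p"
proof -
  interpret R: finite_simple_relation "verts G" "dominates G" by (rule dominates_relation)
  let ?H = "lists_graph ps"
  have CH: "subgraph C ?H" and conn: "connected C"
    and max: "\<And>H'. H' \<noteq> C \<Longrightarrow> subgraph C H' \<Longrightarrow> subgraph H' ?H \<Longrightarrow> \<not> connected H'"
    using C by (auto simp: components_def pre_digraph.max_subgraph_def)
  interpret C: wf_digraph C using CH by auto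
  have cmp: "tail C = tail G" "head C = head G"
    using CH by (auto simp: subgraph_def compatible_def lists_graph_def)
  have aC: "\<exists>q\<in>#ps. (tail G a, head G a) \<in> consecutive q" if "a \<in> arcs C" for a
    using that CH by (auto simp: subgraph_def lists_graph_def arc_to_ends_def)
  obtain v where v: "v \<in> verts C" using conn by (auto simp: connected_def strongly_connected_def)
  have "v \<in> verts G" using v CH by (auto simp: subgraph_def lists_graph_def)
  then have "v \<in># vsum ps" using ps by (simp add: R.lpart_def)
  then obtain p where p: "p \<in># ps" "v \<in> set p" by (auto simp: vsum_def)
  have stay: "y \<in> set p" if "x \<in> set p" "(x, y) \<in> consecutive q" "q \<in># ps" for x y q
    using R.lpart_disjoint[OF ps p(1) that(3)] that consecutive_in_set by metis
  have sub: "verts C \<subseteq> set p"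
  proof
    fix u assume "u \<in> verts C"
    then have "v \<rightarrow>\<^sup>*\<^bsub>mk_symmetric C\<^esub> u"
      using conn v by (auto simp: connected_def strongly_connected_def)
    then have "(v, u) \<in> (arcs_ends (mk_symmetric C))\<^sup>*" by (rule reachable_rtranclI)
    then show "u \<in> set p"
    proof (induction rule: rtrancl_induct)
      case (step x y)
      then obtain a where "a \<in> arcs C"
        "(x, y) = (tail G a, head G a) \<or> (x, y) = (head G a, tail G a)"
        by (auto simp: parcs_mk_symmetric cmp)
      then show ?case using aC stay step.IH consecutive_sym by (metis prod.inject)
    qed (use p in simp)
  qed
  have lp: "successively (dominates G) p" "p \<noteq> []"
    using ps p(1) by (auto simp: R.lpart_def R.lpath_def)
  have pV: "set p \<subseteq> verts G"
  proof
    fix u assume "u \<in> set p"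
    then have "u \<in># vsum ps" using p(1) by (auto simp: vsum_def)
    then show "u \<in> verts G" using ps by (simp add: R.lpart_def)
  qed
  have "a \<in> arcs (list_graph p)" if a: "a \<in> arcs C" for a
  proof -
    obtain q where q: "q \<in># ps" "(tail G a, head G a) \<in> consecutive q" using aC a by blast
    have "tail G a \<in> set p" using C.tail_in_verts[OF a] sub cmp by auto
    then have "q = p" using R.lpart_disjoint[OF ps p(1) q(1)] consecutive_in_set q(2) by metis
    moreover have "a \<in> arcs G" using a CH by (auto simp: subgraph_def lists_graph_def)
    ultimately show ?thesis using q by (simp add: list_graph_def arc_to_ends_def)
  qed
  then have "subgraph C (list_graph p)"
    using sub cmp C.wf_digraph wf_list_graph by (auto simp: subgraph_def compatible_def list_graph_def)
  moreover have "subgraph (list_graph p) ?H"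
    using wf_list_graph[of p] subgraph_lists_graph[of ps] p(1) pV
    by (auto simp: subgraph_def compatible_def list_graph_def lists_graph_def)
  ultimately have "list_graph p = C" using max connected_list_graph[OF pV lp] by blast
  then show ?thesis using p(1) by blast
qed

lemma path_factor_lists_graph:
  assumes ps: "finite_simple_relation.lpart (verts G) (dominates G) ps" "\<forall>p\<in>#ps. k \<le> length p"
  shows "path_factor k (lists_graph ps) G"
proof -
  interpret R: finite_simple_relation "verts G" "dominates G" by (rule dominates_relation)
  have "\<exists>n\<ge>k. path_graph n C" if C: "C \<in> components (lists_graph ps)" for C
  proof -
    obtain p where p: "p \<in># ps" "C = list_graph p" using component_of_lists_graph[OF ps(1) C] by blast
    have "set p \<subseteq> set_mset (vsum ps)" using p(1) by (auto simp: vsum_def)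
    then have pV: "set p \<subseteq> verts G" using ps by (simp add: R.lpart_def)
    have "successively (dominates G) p" using ps p(1) by (simp add: R.lpart_def R.lpath_def)
    \<comment> \<open>\<open>consecutive p\<close> is the relation demanded by
      \<open>path_graph\<close>, with \<open>length p\<close> as the number of vertices.\<close>
    from arcs_ends_list_graph[OF this] have "path_graph (length p) C"
      unfolding path_graph_def p(2) using graph_list_graph[OF pV] R.lpart_distinct[OF ps(1) p(1)]
      by (auto intro!: exI[of _ p] simp: list_graph_def consecutive_def)
    then show ?thesis using ps(2) p(1) by blast
  qed
  moreover have "spanning (lists_graph ps) G"
    using subgraph_lists_graph by (simp add: spanning_def lists_graph_def)
  ultimately show ?thesis using graph_lists_graph by (simp add: path_factor_def)
qed

section \<open>Degrees and induced stars in terms of adjacency\<close>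

lemma out_degree_eq_card_nbrs: "out_degree G v = card {w. v \<rightarrow>\<^bsub>G\<^esub> w}"
proof -
  have "inj_on (head G) (out_arcs G v)"
    by (auto intro!: inj_onI no_multi_arcs simp: arc_to_ends_def)
  moreover have "head G ` out_arcs G v = {w. v \<rightarrow>\<^bsub>G\<^esub> w}"
    by (auto simp: arcs_ends_conv image_iff)
  ultimately show ?thesis unfolding out_degree_def by (metis card_image)
qed

text \<open>Any \<open>r\<close> elements of \<open>S\<close> would span an induced star with
  \<open>x\<close>. A nonempty \<open>S\<close> makes \<open>x\<close> a vertex; for
  \<open>S = {}\<close> and \<open>r = 0\<close> it may fail to be one, hence the second
  disjunct.\<close>

lemma star_free_card:
  assumes sf: "star_free r G" and S: "S \<subseteq> {w. x \<rightarrow>\<^bsub>G\<^esub> w}" "\<forall>u\<in>S. \<forall>v\<in>S. \<not> u \<rightarrow>\<^bsub>G\<^esub> v"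
  shows "card S < r \<or> S = {}"
proof (rule ccontr)
  assume neg: "\<not> (card S < r \<or> S = {})"
  then obtain T where T: "T \<subseteq> S" "card T = r" by (meson not_less obtain_subset_with_card_n)
  define W where "W = insert x T"
  define H where "H = \<lparr>verts = W, arcs = {a \<in> arcs G. arc_to_ends G a \<in> W \<times> W},
     tail = tail G, head = head G\<rparr>"
  have xV: "x \<in> verts G" using neg S(1) adj_in_verts by blast
  have WV: "W \<subseteq> verts G" using T S(1) xV adj_in_verts by (auto simp: W_def)
  have wf: "wf_digraph H" by unfold_locales (auto simp: H_def arc_to_ends_def)
  have sub: "subgraph H G"
    using wf WV wf_digraph by (auto simp: subgraph_def compatible_def H_def)
  have ind: "induced_subgraph H G"
    using sub by (auto simp: induced_subgraph_def H_def arc_to_ends_def)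
  have gH: "graph H"
    by (rule graph_of_symmetric_ends[OF sub, of "W \<times> W"]) (auto simp: H_def intro!: symI)
  have xT: "x \<notin> T" using T S(1) adj_not_same by blast
  have "arc_to_ends H = arc_to_ends G" by (rule ext) (simp add: arc_to_ends_def H_def)
  then have "arcs_ends H = arcs_ends G \<inter> (W \<times> W)"
    unfolding arcs_ends_restrict[symmetric] by (simp add: arcs_ends_def H_def)
  also have "\<dots> = {x} \<times> T \<union> T \<times> {x}"
  proof -
    have "\<not> u \<rightarrow>\<^bsub>G\<^esub> v" if "u \<in> T" "v \<in> T" for u v
      using T(1) S(2) that by blast
    moreover have xu: "x \<rightarrow>\<^bsub>G\<^esub> u" if "u \<in> T" for u
      using T(1) S(1) that by blast
    moreover have "u \<rightarrow>\<^bsub>G\<^esub> x" if "u \<in> T" for u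
      using graph_symmetric[OF xu[OF that]] .
    moreover have "\<not> x \<rightarrow>\<^bsub>G\<^esub> x" using adj_not_same by blast
    ultimately show ?thesis by (auto simp: W_def)
  qed
  finally have "verts H = {x} \<union> T \<and> {x} \<inter> T = {} \<and> card {x} = 1 \<and> card T = r \<and>
      arcs_ends H = {x} \<times> T \<union> T \<times> {x}"
    using xT T(2) by (simp add: H_def W_def)
  then have "complete_bipartite_digraph 1 r H"
    unfolding complete_bipartite_digraph_def using gH by blast
  then show False using sf ind by (auto simp: star_free_def)
qed

end

theorem theorem9:
  fixes G :: "('a,'b) pre_digraph" and r :: nat
  assumes "r \<ge> 3"
    and "graph G"
    and "star_free r G"
    and "min_degree G \<ge> r div 2 + 2"
  shows "path_factor_covered 3 G"
  unfolding path_factor_covered_def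
proof
  fix e assume e: "e \<in> arcs G"
  interpret graph G by (rule assms(2))
  interpret R: finite_simple_relation "verts G" "dominates G" by (rule dominates_relation)
  have cd: "tail G e \<rightarrow>\<^bsub>G\<^esub> head G e" using e by (auto simp: arcs_ends_conv)
  have deg: "\<forall>v\<in>verts G. r div 2 + 2 \<le> card {w. v \<rightarrow>\<^bsub>G\<^esub> w}"
  proof
    fix v assume "v \<in> verts G"
    then have "min_degree G \<le> out_degree G v" by (simp add: min_degree_def)
    then show "r div 2 + 2 \<le> card {w. v \<rightarrow>\<^bsub>G\<^esub> w}" using assms(4) out_degree_eq_card_nbrs by simp
  qed
  have star: "\<forall>x S. S \<subseteq> {w. x \<rightarrow>\<^bsub>G\<^esub> w} \<and> (\<forall>u\<in>S. \<forall>v\<in>S. \<not> u \<rightarrow>\<^bsub>G\<^esub> v) \<longrightarrow> card S < r"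
    using star_free_card[OF assms(3)] assms(1) by fastforce
  obtain ps A B where ps: "R.lpart ps" "\<forall>p\<in>#ps. 3 \<le> length p"
    "A @ [tail G e, head G e] @ B \<in># ps"
    using R.long_lpart_through_edge[OF cd assms(1) deg star] by blast
  have "\<exists>p\<in>#ps. (tail G e, head G e) \<in> consecutive p"
    by (rule bexI[OF _ ps(3)]) (rule consecutive_middle)
  then have "e \<in> arcs (lists_graph ps)"
    using e by (simp add: lists_graph_def arc_to_ends_def)
  then show "\<exists>H. path_factor 3 H G \<and> e \<in> arcs H"
    using path_factor_lists_graph[OF ps(1,2)] by blast
qed

end
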